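(* Let $\alpha,\beta,k\ge 0$ be integers. For every integer $n\ge 0$, $$p_{3^{2\alpha+2},3}\left(3^{2\alpha+2\beta+1}n+\frac{2\cdot 3^{2\alpha+2\beta+1}+3^{2\alpha+2}+1}{8}\right)\equiv 0\pmod{3^{3\alpha+2\beta+2}},$$ $$p_{3^{2\alpha+2},3}\left(3^{2\alpha+2\beta+2}n+\frac{10\cdot 3^{2\alpha+2\beta+1}+3^{2\alpha+2}+1}{8}\right)\equiv 0\pmod{3^{3\alpha+2\beta+3}},$$ $$p_{3^{2\alpha+2},3}\left(3^{2\alpha+2\beta+3}n+\frac{14\cdot 3^{2\alpha+2\beta+2}+3^{2\alpha+2}+1}{8}\right)\equiv 0\pmod{3^{3\alpha+2\beta+6}},$$ $$p_{3^{2\alpha+2},3}\left(3^{2\alpha+2\beta+3}n+\frac{22\cdot 3^{2\alpha+2\beta+2}+3^{2\alpha+2}+1}{8}\right)\equiv 0\pmod{3^{3\alpha+2\beta+7}}.$$ Moreover, for every prime $p\equiv 3\pmod 4$ and every integer $n\ge 0$ with $p\nmid n$, $$p_{3^{2\alpha+2},3}\left(3^{2\alpha+2\beta+1}p^{2k+1}n+\frac{2p^{2k+2}\cdot 3^{2\alpha+2\beta+1}+3^{2\alpha+2}+1}{8}\right)\equiv 0\pmod{3^{3\alpha+2\beta+4}}.$$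
   Context: $E(q^r)=\prod_{m\ge 1}(1-q^{rm})$. For a positive integer $\ell$, $p_{\ell,3}(n)$ (the number of 2-color partition triples of $n$ in which one of the colors appears only in parts that are multiples of $\ell$) is defined by $\sum_{n\ge 0}p_{\ell,3}(n)q^n=\dfrac{1}{E(q)^3E(q^\ell)^3}$. *)

theory Defs
  imports
    "HOL-Analysis.Analysis"
    "HOL-Number_Theory.Number_Theory"
begin

text \<open>
  The infinite product is taken in the usual (formal) topology of \<^typ>\<open>int fps\<close>.
\<close>
definition E :: "nat \<Rightarrow> int fps" where
  "E r = (\<Prod>m. 1 - fps_X ^ (r * Suc m))"

text \<open>
  \<^term>\<open>fps_left_inverse F 1\<close> is the multiplicative inverse of a power series over a commutative
  ring whose constant coefficient is 1; \<^const>\<open>inverse\<close> on power series would require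
  an inverse operation on the coefficients, which \<^typ>\<open>int\<close> lacks.
\<close>
definition p3 :: "nat \<Rightarrow> nat \<Rightarrow> int" where
  "p3 l n = fps_nth (fps_left_inverse (E 1 ^ 3 * E l ^ 3) 1) n"

lemma E_has_prod:
  assumes "r > 0"
  shows "(\<lambda>m. 1 - fps_X ^ (r * Suc m)) has_prod E r" and "fps_nth (E r) 0 = 1"
proof -
  define f :: "nat \<Rightarrow> int fps" where "f m = 1 - fps_X ^ (r * Suc m)" for m
  define P where "P N = (\<Prod>i\<le>N. f i)" for N
  have step: "fps_nth (P (Suc N)) n = fps_nth (P N) n" if "n \<le> N" for n N
  proof -
    have "P (Suc N) = P N - P N * fps_X ^ (r * Suc (Suc N))"
      unfolding P_def prod.atMost_Suc f_def[of "Suc N"] right_diff_distrib mult_1_right ..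
    moreover have "n < r * Suc (Suc N)"
    proof -
      have "n < 1 * Suc (Suc N)" using that by simp
      also have "\<dots> \<le> r * Suc (Suc N)" using assms by (intro mult_le_mono1) simp
      finally show ?thesis .
    qed
    ultimately show ?thesis by (simp only: fps_sub_nth fps_X_power_mult_right_nth if_True diff_0_right)
  qed
  have stable: "fps_nth (P N) n = fps_nth (P n) n" if "n \<le> N" for n N
    using that by (induction N rule: dec_induct) (auto simp: step)
  define L where "L = Abs_fps (\<lambda>n. fps_nth (P n) n)"
  have lim: "P \<longlonglongrightarrow> L"
    unfolding L_def
    by (rule tendsto_fpsI) (auto simp: eventually_sequentially intro: stable)
  have L0: "fps_nth L 0 = 1"
    using assms by (simp add: L_def P_def f_def)
  then have "L \<noteq> 0" by auto
  then have "f has_prod L"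
    using lim unfolding has_prod_def raw_has_prod_def P_def by simp
  moreover from this have "E r = L"
    unfolding E_def f_def by (metis has_prod_unique)
  ultimately show "(\<lambda>m. 1 - fps_X ^ (r * Suc m)) has_prod E r" "fps_nth (E r) 0 = 1"
    using L0 by (simp_all only: f_def[abs_def])
qed

lemma p3_generating_function:
  assumes "l > 0"
  shows "Abs_fps (p3 l) * (E 1 ^ 3 * E l ^ 3) = 1"
proof -
  have "Abs_fps (p3 l) = fps_left_inverse (E 1 ^ 3 * E l ^ 3) 1"
    by (rule fps_ext) (simp only: p3_def fps_nth_Abs_fps)
  then show ?thesis
    using fps_left_inverse[of 1 "E 1 ^ 3 * E l ^ 3"] assms
    by (simp add: E_has_prod(2) fps_nth_power_0)
qed

end

(* Everything rests on the 3-dissection E(q)^3 = A(q^3) - 3 q E(q^9)^3, which is read off Jacobi's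
   identity E(q)^3 = sum (-1)^k (2k+1) q^(k(k+1)/2). Taking the product over the cube roots of unity
   w of E(wq) gives A(q)^3 - 27 q E(q^3)^9 = E(q)^12 / E(q^3)^3. Hence v = 3 q E(q^9)^3 / E(q)^3
   (cubic_quot below) satisfies v^3 = T(q^3) (1 + 3v + 3v^2), where T = 27 q E(q^3)^12 / E(q)^12
   (haupt below) is 27 times a Hauptmodul of Gamma_0(3). Therefore the operator U that extracts
   the exponents divisible by 3 maps v^k to a polynomial in T that is divisible by a power of T with
   exponent about k/3. Since T = 9 v^4 / T(q^3), this controls U on v^b Z[T], and after a suitable
   number of extractions the generating function becomes 3^N times E(q^3)^6 / E(q)^12 or
   E(q^3)^12 / E(q)^18 times an element of Z[T]. As 27 divides T, only the constant term of that
   element matters for the congruences. The last family holds because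
   E(q^3)^6 / E(q)^12 is congruent to E(q)^6 modulo 9, and the coefficient of q^m in E(q)^6
   vanishes unless 4m + 1 is a sum of two squares. *)

theory Submission
  imports Defs "HOL-Computational_Algebra.Formal_Laurent_Series"
begin

section \<open>Sections of power series\<close>

text \<open>The powers of 3 arise as follows. \<open>cubic_quot\<close> contains one factor 3 and
  \<open>haupt\<close> contains 27. For b = 4, 5, 6 the extraction turns v^b times an element of
  Z[T] into T^2 times such an element; comparing the factor 3^b q^b of v^b with the factor 3^6 q^2
  of T^2 leaves a gain of 3^(6 - b) on the exponents congruent to 6 - b modulo 3. The exponents of
  E(q^3) and 1/E(q) then run through two cycles of length two. The first (b = 4, then 5) gains 27
  per round and accounts for 3 \<alpha>; the second (b = 4, then 6) gains 9 per round and accounts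
  for 2 \<beta>; the initial extraction from 1/E(q)^3 gains 9. The switch between the cycles occurs
  at modulus 3^(2 \<alpha> + 1): 1/E(q^l)^3 with l = 3^(2 \<alpha> + 2) passes unchanged through all
  extractions before it and then enters as 1/E(q^3)^3. Families two to four use one more extraction,
  where the coefficients of 1/E(q)^12 and 1/E(q)^18 at exponents prime to 3 supply the factors 3, 9
  and 27.\<close>

definition sect :: "nat \<Rightarrow> nat \<Rightarrow> 'a fps \<Rightarrow> 'a fps" where
  "sect m r F = Abs_fps (\<lambda>n. fps_nth F (m * n + r))"

lemma sect_nth [simp]: "fps_nth (sect m r F) n = fps_nth F (m * n + r)"
  by (simp add: sect_def)

lemma sect_add [simp]: "sect m r (F + G) = sect m r F + sect m r G"
  by (simp add: fps_eq_iff)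

lemma sect_diff [simp]: "sect m r (F - G :: 'a::group_add fps) = sect m r F - sect m r G"
  by (simp add: fps_eq_iff)

lemma sect_sect: "sect m r (sect k s F) = sect (k * m) (k * r + s) F"
  by (simp add: fps_eq_iff algebra_simps)

text \<open>A series in q^m acts as a scalar. The coefficient of G(q^m) vanishes unless the index of
  F is congruent to r modulo m, and since r < m those indices up to m * n + r are exactly m * j + r
  with j \<le> n.\<close>

lemma sect_mult_compose:
  fixes F G :: "'a::idom fps"
  assumes "r < m"
  shows "sect m r (F * (G oo fps_X ^ m)) = sect m r F * G"
proof (rule fps_ext)
  fix n
  let ?h = "\<lambda>i. fps_nth F i * fps_nth (G oo fps_X ^ m) (m * n + r - i)"
  have m: "m > 0" using assms by simp
  have inj: "inj_on (\<lambda>j. m * j + r) {0..n}"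
    using m by (auto simp: inj_on_def)
  have sub: "(\<lambda>j. m * j + r) ` {0..n} \<subseteq> {0..m * n + r}"
    by auto
  have zero: "?h i = 0" if i: "i \<in> {0..m * n + r} - (\<lambda>j. m * j + r) ` {0..n}" for i
  proof (cases "m dvd (m * n + r - i)")
    case True
    then obtain c where c: "m * n + r - i = m * c" by auto
    have "m * c < m * Suc n" using c assms by simp
    then have cn: "c \<le> n" using mult_less_cancel1[of m c "Suc n"] by linarith
    have "i = m * n + r - m * c" using c i by (metis DiffD1 atLeastAtMost_iff diff_diff_cancel)
    also have "\<dots> = m * (n - c) + r" using cn by (simp add: diff_mult_distrib2)
    finally have "i \<in> (\<lambda>j. m * j + r) ` {0..n}" by auto
    then show ?thesis using i by simp
  next
    case False
    then show ?thesis using m by (simp add: fps_nth_compose_X_power)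
  qed
  have "fps_nth (sect m r (F * (G oo fps_X ^ m))) n = (\<Sum>i=0..m * n + r. ?h i)"
    by (simp add: fps_mult_nth)
  also have "\<dots> = (\<Sum>i\<in>(\<lambda>j. m * j + r) ` {0..n}. ?h i)"
    using sub zero by (intro sum.mono_neutral_right) auto
  also have "\<dots> = (\<Sum>j=0..n. ?h (m * j + r))"
    by (subst sum.reindex[OF inj]) simp
  also have "\<dots> = (\<Sum>j=0..n. fps_nth F (m * j + r) * fps_nth G (n - j))"
  proof (intro sum.cong refl)
    fix j assume "j \<in> {0..n}"
    then have "m * n + r - (m * j + r) = m * (n - j)" by (simp add: diff_mult_distrib2)
    then show "?h (m * j + r) = fps_nth F (m * j + r) * fps_nth G (n - j)"
      using m by (simp add: fps_nth_compose_X_power)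
  qed
  also have "\<dots> = fps_nth (sect m r F * G) n"
    by (simp add: fps_mult_nth)
  finally show "fps_nth (sect m r (F * (G oo fps_X ^ m))) n = fps_nth (sect m r F * G) n" .
qed

lemma sect_X_power_mult_le:
  fixes F :: "'a::comm_ring_1 fps"
  assumes "s \<le> r" "r < m"
  shows "sect m r (fps_X ^ (m * k + s) * F) = fps_X ^ k * sect m (r - s) F"
proof (rule fps_ext)
  fix n
  show "fps_nth (sect m r (fps_X ^ (m * k + s) * F)) n = fps_nth (fps_X ^ k * sect m (r - s) F) n"
  proof (cases "n < k")
    case True
    then have "m * Suc n \<le> m * k" by (intro mult_le_mono2) simp
    then have "m * n + r < m * k + s" using assms by simp
    then show ?thesis using True by (simp add: fps_X_power_mult_nth)
  next
    case False
    then obtain d where "n = k + d" by (metis le_Suc_ex not_less)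
    then have "m * n + r = (m * k + s) + (m * d + (r - s))"
      using assms by (simp add: algebra_simps)
    then show ?thesis using \<open>n = k + d\<close> assms
      by (simp only: sect_nth fps_X_power_mult_nth) simp
  qed
qed

text \<open>The residue r - s is negative here, so one m is borrowed, and it reappears as an
  additional factor \<open>fps_X\<close>.\<close>

lemma sect_X_power_mult_gt:
  fixes F :: "'a::comm_ring_1 fps"
  assumes "r < s" "s < m"
  shows "sect m r (fps_X ^ (m * k + s) * F) = fps_X ^ Suc k * sect m (m + r - s) F"
proof (rule fps_ext)
  fix n
  show "fps_nth (sect m r (fps_X ^ (m * k + s) * F)) n
          = fps_nth (fps_X ^ Suc k * sect m (m + r - s) F) n"
  proof (cases "n < Suc k")
    case True
    then have "m * n \<le> m * k" by (intro mult_le_mono2) simp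
    then have "m * n + r < m * k + s" using assms by linarith
    then show ?thesis using True by (simp add: fps_X_power_mult_nth del: power_Suc)
  next
    case False
    then obtain d where "n = Suc k + d" by (metis le_Suc_ex not_less)
    then have "m * n + r = (m * k + s) + (m * d + (m + r - s))"
      using assms by (simp add: algebra_simps)
    then show ?thesis using \<open>n = Suc k + d\<close> assms
      by (simp only: sect_nth fps_X_power_mult_nth) simp
  qed
qed

lemma fps_three_sections:
  fixes F :: "'a::idom fps"
  shows "F = (sect 3 0 F oo fps_X ^ 3) + fps_X * (sect 3 1 F oo fps_X ^ 3)
               + fps_X ^ 2 * (sect 3 2 F oo fps_X ^ 3)"
proof (rule fps_ext)
  fix n
  have *: "fps_nth (fps_X ^ s * (sect 3 s F oo fps_X ^ 3)) n
             = (if n mod 3 = s then fps_nth F n else 0)" if "s < 3" for s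
  proof (cases "s \<le> n")
    case True
    then obtain d where d: "n = s + d" by (metis le_Suc_ex)
    have "3 dvd d \<longleftrightarrow> n mod 3 = s" using that d by presburger
    then show ?thesis using d
        by (auto simp: fps_X_power_mult_nth fps_nth_compose_X_power add.commute)
  next
    case False
    then show ?thesis using that by (simp add: fps_X_power_mult_nth)
  qed
  have "n mod 3 = 0 \<or> n mod 3 = 1 \<or> n mod 3 = 2" by auto
  then show "fps_nth F n = fps_nth ((sect 3 0 F oo fps_X ^ 3) + fps_X * (sect 3 1 F oo fps_X ^ 3)
               + fps_X ^ 2 * (sect 3 2 F oo fps_X ^ 3)) n"
    using *[of 0] *[of 1] *[of 2] by auto
qed

lemma fps_compose_X_power_ring_simps:
  fixes F G :: "'a::idom fps"
  assumes "m > 0"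
  shows "(F + G) oo fps_X ^ m = (F oo fps_X ^ m) + (G oo fps_X ^ m)"
    "(F - G) oo fps_X ^ m = (F oo fps_X ^ m) - (G oo fps_X ^ m)"
    "(F * G) oo fps_X ^ m = (F oo fps_X ^ m) * (G oo fps_X ^ m)"
    "(F ^ n) oo fps_X ^ m = (F oo fps_X ^ m) ^ n"
    "fps_X oo fps_X ^ m = (fps_X ^ m :: 'a fps)"
    "numeral k oo fps_X ^ m = (numeral k :: 'a fps)"
    "1 oo fps_X ^ m = (1 :: 'a fps)"
  using assms
  by (simp_all add: fps_compose_add_distrib fps_compose_sub_distrib fps_compose_mult_distrib
      fps_compose_power fps_X_power_compose numeral_fps_const)

text \<open>Multiplication in the basis 1, q, q^2 over series in q^3: residues adding up to 3 or 4
  carry a q^3, which is read as \<open>fps_X\<close>.\<close>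

lemma sect_three_mult:
  fixes F G :: "'a::idom fps"
  shows "sect 3 0 (F * G) = sect 3 0 F * sect 3 0 G
           + fps_X * (sect 3 1 F * sect 3 2 G + sect 3 2 F * sect 3 1 G)"
    and "sect 3 1 (F * G) = sect 3 0 F * sect 3 1 G + sect 3 1 F * sect 3 0 G
           + fps_X * (sect 3 2 F * sect 3 2 G)"
    and "sect 3 2 (F * G) = sect 3 0 F * sect 3 2 G + sect 3 1 F * sect 3 1 G
           + sect 3 2 F * sect 3 0 G"
proof -
  let ?a = "sect 3 0 F" and ?b = "sect 3 1 F" and ?c = "sect 3 2 F"
  let ?X = "fps_X :: 'a fps"
  have "G * F = G * (?a oo ?X ^ 3) + ?X ^ 1 * (G * (?b oo ?X ^ 3)) + ?X ^ 2 * (G * (?c oo ?X ^ 3))"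
    by (subst fps_three_sections[of F]) (simp add: algebra_simps)
  then have FG: "F * G = G * (?a oo ?X ^ 3) + ?X ^ 1 * (G * (?b oo ?X ^ 3))
      + ?X ^ 2 * (G * (?c oo ?X ^ 3))"
    by (simp add: mult.commute)
  note le = sect_X_power_mult_le[where 'a = 'a and m = 3 and k = 0, simplified]
  note gt = sect_X_power_mult_gt[where 'a = 'a and m = 3 and k = 0, simplified]
  have "sect 3 0 (F * G) = sect 3 0 G * ?a + fps_X * (sect 3 2 G * ?b) + fps_X * (sect 3 1 G * ?c)"
    unfolding FG using gt[of 0 1] gt[of 0 2] by (simp add: sect_mult_compose)
  then show "sect 3 0 (F * G) = sect 3 0 F * sect 3 0 G
           + fps_X * (sect 3 1 F * sect 3 2 G + sect 3 2 F * sect 3 1 G)"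
    by (simp add: algebra_simps)
  have "sect 3 1 (F * G) = sect 3 1 G * ?a + sect 3 0 G * ?b + fps_X * (sect 3 2 G * ?c)"
    unfolding FG using le[of 1 1] gt[of 1 2] by (simp add: sect_mult_compose)
  then show "sect 3 1 (F * G) = sect 3 0 F * sect 3 1 G + sect 3 1 F * sect 3 0 G
           + fps_X * (sect 3 2 F * sect 3 2 G)"
    by (simp add: algebra_simps)
  have "sect 3 2 (F * G) = sect 3 2 G * ?a + sect 3 1 G * ?b + sect 3 0 G * ?c"
    unfolding FG using le[of 1 2] le[of 2 2] by (simp add: sect_mult_compose)
  then show "sect 3 2 (F * G) = sect 3 0 F * sect 3 2 G + sect 3 1 F * sect 3 1 G
           + sect 3 2 F * sect 3 0 G"
    by (simp add: algebra_simps)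
qed

text \<open>This is the norm from power series in \<open>q\<close> to power series in \<open>q\<^sup>3\<close>,
  i.e. the product of \<open>F(q)\<close>, \<open>F(\<omega>q)\<close>, \<open>F(\<omega>\<^sup>2q)\<close> with \<open>\<omega>\<close> a primitive cube root of unity,
  read as a series in \<open>q\<close>.\<close>

definition norm3 :: "'a::idom fps \<Rightarrow> 'a fps" where
  "norm3 F = sect 3 0 F ^ 3 + fps_X * sect 3 1 F ^ 3 + fps_X ^ 2 * sect 3 2 F ^ 3
     - 3 * fps_X * sect 3 0 F * sect 3 1 F * sect 3 2 F"

text \<open>Multiplicativity of the norm form for adjoining a cube root of x; as a polynomial
  identity it avoids roots of unity.\<close>

lemma ring_identity_norm3:
  fixes a b c a' b' c' x :: "'a::comm_ring_1"
  shows "(a * a' + x * (b * c' + c * b')) ^ 3 + x * (a * b' + b * a' + x * (c * c')) ^ 3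
      + x ^ 2 * (a * c' + b * b' + c * a') ^ 3
      - 3 * x * (a * a' + x * (b * c' + c * b')) * (a * b' + b * a' + x * (c * c'))
          * (a * c' + b * b' + c * a')
    = (a ^ 3 + x * b ^ 3 + x ^ 2 * c ^ 3 - 3 * x * a * b * c)
      * (a' ^ 3 + x * b' ^ 3 + x ^ 2 * c' ^ 3 - 3 * x * a' * b' * c')"
  by (simp add: power2_eq_square power3_eq_cube algebra_simps)

lemma norm3_mult: "norm3 (F * G) = norm3 F * norm3 G"
proof -
  show ?thesis
    unfolding norm3_def sect_three_mult by (rule ring_identity_norm3)
qed

lemma norm3_power: "norm3 (F ^ n) = norm3 F ^ n"
proof (induction n)
  case 0
  have "sect 3 0 (1 :: 'a fps) = 1" "sect 3 1 (1 :: 'a fps) = 0" "sect 3 2 (1 :: 'a fps) = 0"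
    by (simp_all add: fps_eq_iff)
  then show ?case by (simp add: norm3_def)
qed (simp add: norm3_mult)

section \<open>Euler's product and its norm\<close>

text \<open>Congruence modulo q^(n + 1), through which identities between finite products pass to
  E.\<close>

definition eq_upto :: "nat \<Rightarrow> 'a fps \<Rightarrow> 'a fps \<Rightarrow> bool" where
  "eq_upto n F G \<longleftrightarrow> (\<forall>i\<le>n. fps_nth F i = fps_nth G i)"

lemma eq_upto_refl [simp]: "eq_upto n F F"
  by (simp add: eq_upto_def)

lemma eq_upto_sym: "eq_upto n F G \<Longrightarrow> eq_upto n G F"
  by (simp add: eq_upto_def)

lemma eq_upto_trans: "eq_upto n F G \<Longrightarrow> eq_upto n G H \<Longrightarrow> eq_upto n F H"
  by (simp add: eq_upto_def)

lemma eq_upto_mono: "eq_upto n F G \<Longrightarrow> m \<le> n \<Longrightarrow> eq_upto m F G"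
  by (simp add: eq_upto_def)

lemma eq_upto_add: "eq_upto n F G \<Longrightarrow> eq_upto n F' G' \<Longrightarrow> eq_upto n (F + F') (G + G')"
  by (simp add: eq_upto_def)

lemma eq_upto_diff:
  fixes F G :: "'a::group_add fps"
  shows "eq_upto n F G \<Longrightarrow> eq_upto n F' G' \<Longrightarrow> eq_upto n (F - F') (G - G')"
  by (simp add: eq_upto_def)

lemma eq_upto_mult:
  fixes F G :: "'a::comm_ring_1 fps"
  shows "eq_upto n F G \<Longrightarrow> eq_upto n F' G' \<Longrightarrow> eq_upto n (F * F') (G * G')"
  by (auto simp: eq_upto_def fps_mult_nth intro!: sum.cong)

lemma eq_upto_power:
  fixes F G :: "'a::comm_ring_1 fps"
  shows "eq_upto n F G \<Longrightarrow> eq_upto n (F ^ k) (G ^ k)"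
  by (induction k) (auto intro: eq_upto_mult)

lemma eq_upto_sum:
  fixes F G :: "'b \<Rightarrow> 'a::comm_ring_1 fps"
  shows "(\<And>k. k \<in> A \<Longrightarrow> eq_upto n (F k) (G k)) \<Longrightarrow> eq_upto n (sum F A) (sum G A)"
  by (auto simp: eq_upto_def fps_sum_nth intro!: sum.cong)

lemma eq_upto_X_power_mult:
  fixes F G :: "'a::comm_ring_1 fps"
  shows "eq_upto n F G \<Longrightarrow> eq_upto (k + n) (fps_X ^ k * F) (fps_X ^ k * G)"
  by (auto simp: eq_upto_def fps_X_power_mult_nth)

lemma eq_upto_sect: "eq_upto (m * n + r) F G \<Longrightarrow> eq_upto n (sect m r F) (sect m r G)"
  by (auto simp: eq_upto_def)

lemma eq_upto_all: "(\<And>n. eq_upto n F G) \<Longrightarrow> F = G"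
  by (auto simp: eq_upto_def fps_eq_iff)

lemma eq_upto_norm3:
  assumes "eq_upto (3 * n + 2) F G"
  shows "eq_upto n (norm3 F) (norm3 G)"
proof -
  have "eq_upto n (sect 3 r F) (sect 3 r G)" if "r \<le> 2" for r
    using assms that by (intro eq_upto_sect eq_upto_mono[OF assms]) auto
  then show ?thesis
    unfolding norm3_def
    by (intro eq_upto_add eq_upto_diff eq_upto_mult eq_upto_power eq_upto_refl) auto
qed

definition Eprod :: "nat \<Rightarrow> nat \<Rightarrow> int fps" where
  "Eprod r n = (\<Prod>m<n. 1 - fps_X ^ (r * Suc m))"

lemma Eprod_0 [simp]: "Eprod r 0 = 1"
  by (simp add: Eprod_def)

lemma Eprod_Suc: "Eprod r (Suc n) = Eprod r n * (1 - fps_X ^ (r * Suc n))"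
  by (simp add: Eprod_def)

lemma Eprod_stable:
  assumes "r > 0" "N \<le> M"
  shows "eq_upto N (Eprod r M) (Eprod r N)"
  using assms(2)
proof (induction M rule: dec_induct)
  case (step M)
  have "N < r * Suc M"
  proof -
    have "N < 1 * Suc M" using step by simp
    also have "\<dots> \<le> r * Suc M" using assms by (intro mult_le_mono1) simp
    finally show ?thesis .
  qed
  then have "eq_upto N (1 - fps_X ^ (r * Suc M) :: int fps) 1"
    by (auto simp: eq_upto_def fps_X_power_nth)
  then have "eq_upto N (Eprod r (Suc M)) (Eprod r N * 1)"
    unfolding Eprod_Suc using step by (intro eq_upto_mult) auto
  then show ?case by simp
qed simp

lemma E_eq_upto_Eprod:
  assumes "r > 0" "n \<le> N"
  shows "eq_upto n (E r) (Eprod r N)"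
proof -
  have "(\<lambda>m. 1 - fps_X ^ (r * Suc m) :: int fps) has_prod E r"
    using E_has_prod(1)[OF assms(1)] .
  then have lim: "(\<lambda>n. \<Prod>m\<le>n. 1 - fps_X ^ (r * Suc m) :: int fps) \<longlonglongrightarrow> E r"
    by (rule has_prod_imp_tendsto)
  have "fps_nth (E r) i = fps_nth (Eprod r N) i" if i: "i \<le> n" for i
  proof -
    have "eventually (\<lambda>M. fps_nth (\<Prod>m\<le>M. 1 - fps_X ^ (r * Suc m) :: int fps) i = fps_nth (E r) i)
            sequentially"
      using lim unfolding tendsto_fps_iff by blast
    then obtain M0 where M0: "\<And>M. M \<ge> M0 \<Longrightarrow>
        fps_nth (\<Prod>m\<le>M. 1 - fps_X ^ (r * Suc m) :: int fps) i = fps_nth (E r) i"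
      unfolding eventually_sequentially by blast
    define M where "M = max M0 N"
    have M: "M \<ge> N" "fps_nth (\<Prod>m\<le>M. 1 - fps_X ^ (r * Suc m) :: int fps) i = fps_nth (E r) i"
      using M0[of M] by (simp_all only: M_def max.cobounded1 max.cobounded2)
    have "fps_nth (E r) i = fps_nth (Eprod r (Suc M)) i"
      using M by (simp only: Eprod_def lessThan_Suc_atMost)
    also have "\<dots> = fps_nth (Eprod r N) i"
      using Eprod_stable[of r N "Suc M"] M i assms by (simp add: eq_upto_def)
    finally show ?thesis .
  qed
  then show ?thesis by (simp add: eq_upto_def)
qed

lemma Eprod_compose:
  assumes "s > 0"
  shows "Eprod r n oo fps_X ^ s = Eprod (r * s) n"
proof (induction n)
  case (Suc n)
  have "(fps_X ^ s :: int fps) ^ (r * Suc n) = fps_X ^ (r * s * Suc n)"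
    unfolding power_mult [symmetric] by (simp only: mult_ac)
  then show ?case
    unfolding Eprod_Suc fps_compose_X_power_ring_simps[OF assms] Suc by simp
qed (simp add: fps_compose_X_power_ring_simps[OF assms])

lemma E_compose:
  assumes "r > 0" "s > 0"
  shows "E r oo fps_X ^ s = E (r * s)"
proof (rule fps_ext)
  fix n
  have "fps_nth (E r oo fps_X ^ s) n = fps_nth (Eprod r n oo fps_X ^ s) n"
    using E_eq_upto_Eprod[OF assms(1), of "n div s" n] assms
    by (simp add: fps_nth_compose_X_power eq_upto_def)
  also have "\<dots> = fps_nth (E (r * s)) n"
    using E_eq_upto_Eprod[of "r * s" n n] assms by (simp add: Eprod_compose eq_upto_def)
  finally show "fps_nth (E r oo fps_X ^ s) n = fps_nth (E (r * s)) n" .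
qed

text \<open>For w running through the cube roots of unity, the factors 1 - (w q)^m multiply to 1 -
  q^(3m) if 3 does not divide m, and to (1 - q^m)^3 otherwise; then q^3 is read as q.\<close>

lemma norm3_one_minus_X_power:
  "norm3 (1 - fps_X ^ (3 * k + 1) :: int fps) = 1 - fps_X ^ (3 * k + 1)"
  "norm3 (1 - fps_X ^ (3 * k + 2) :: int fps) = 1 - fps_X ^ (3 * k + 2)"
  "norm3 (1 - fps_X ^ (3 * k) :: int fps) = (1 - fps_X ^ k) ^ 3"
proof -
  have s: "sect 3 r (1 :: int fps) = (if r = 0 then 1 else 0)" for r
    by (auto simp: fps_eq_iff)
  have sX: "sect 3 r (fps_X ^ (3 * k + s) :: int fps) = (if r = s then fps_X ^ k else 0)"
    if "r < 3" "s < 3" for r s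
    using that by (auto simp: fps_eq_iff fps_X_power_nth) presburger+
  show "norm3 (1 - fps_X ^ (3 * k + 1) :: int fps) = 1 - fps_X ^ (3 * k + 1)"
    using sX[of 0 1] sX[of 1 1] sX[of 2 1]
    by (simp add: norm3_def s power_mult [symmetric] mult.commute)
  show "norm3 (1 - fps_X ^ (3 * k + 2) :: int fps) = 1 - fps_X ^ (3 * k + 2)"
    using sX[of 0 2] sX[of 1 2] sX[of 2 2]
    by (simp add: norm3_def s power_mult [symmetric] power2_eq_square mult_ac)
  show "norm3 (1 - fps_X ^ (3 * k) :: int fps) = (1 - fps_X ^ k) ^ 3"
    using sX[of 0 0] sX[of 1 0] sX[of 2 0] by (simp add: norm3_def s)
qed

lemma norm3_Eprod: "norm3 (Eprod 1 (3 * M)) * Eprod 3 M = Eprod 1 (3 * M) * Eprod 1 M ^ 3"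
proof (induction M)
  case 0
  then show ?case using norm3_power[of "1 :: int fps" 0] by simp
next
  case (Suc M)
  have *: "Eprod 1 (3 * Suc M) = Eprod 1 (3 * M) * (1 - fps_X ^ (3 * M + 1)) *
      (1 - fps_X ^ (3 * M + 2)) * (1 - fps_X ^ (3 * Suc M))"
    using Eprod_Suc[of 1 "3 * M"] Eprod_Suc[of 1 "3 * M + 1"] Eprod_Suc[of 1 "3 * M + 2"]
    by (simp add: eval_nat_numeral)
  have "norm3 (Eprod 1 (3 * Suc M)) * Eprod 3 (Suc M)
      = (norm3 (Eprod 1 (3 * M)) * Eprod 3 M) * ((1 - fps_X ^ (3 * M + 1)) *
      (1 - fps_X ^ (3 * M + 2)) * (1 - fps_X ^ (3 * Suc M))) * (1 - fps_X ^ Suc M) ^ 3"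
    unfolding * norm3_mult norm3_one_minus_X_power Eprod_Suc[of 3] by (simp only: mult_ac)
  also have "\<dots> = Eprod 1 (3 * Suc M) * Eprod 1 (Suc M) ^ 3"
    unfolding Suc * Eprod_Suc[of 1 M] power_mult_distrib mult_1 by (simp only: mult_ac)
  finally show ?case .
qed

lemma norm3_E: "norm3 (E 1) * E 3 = E 1 ^ 4"
proof (rule eq_upto_all)
  fix n :: nat
  let ?M = "3 * n + 2"
  have "eq_upto n (norm3 (E 1) * E 3) (norm3 (Eprod 1 (3 * ?M)) * Eprod 3 ?M)"
    by (intro eq_upto_mult eq_upto_norm3 E_eq_upto_Eprod) auto
  moreover have "eq_upto n (E 1 * E 1 ^ 3) (Eprod 1 (3 * ?M) * Eprod 1 ?M ^ 3)"
    by (intro eq_upto_mult eq_upto_power E_eq_upto_Eprod) auto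
  moreover have "E 1 * E 1 ^ 3 = E 1 ^ 4"
    by (simp add: eval_nat_numeral)
  ultimately show "eq_upto n (norm3 (E 1) * E 3) (E 1 ^ 4)"
    unfolding norm3_Eprod by (metis eq_upto_sym eq_upto_trans)
qed

lemma numeral_dvd_fps_iff:
  "(numeral k :: int fps) dvd F \<longleftrightarrow> (\<forall>n. numeral k dvd fps_nth F n)"
proof
  assume "\<forall>n. numeral k dvd fps_nth F n"
  then have "F = numeral k * Abs_fps (\<lambda>n. fps_nth F n div numeral k)"
    by (simp add: fps_eq_iff numeral_fps_const)
  then show "numeral k dvd F" by (rule dvdI)
qed (auto simp: numeral_fps_const)

lemma E_1_cubed_cong: "3 dvd E 1 ^ 3 - E 3"
  unfolding numeral_dvd_fps_iff
proof
  fix n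
  have "3 dvd Eprod 1 N ^ 3 - Eprod 3 N" for N
  proof (induction N)
    case (Suc N)
    let ?x = "fps_X ^ Suc N :: int fps"
    have X3: "fps_X ^ (3 * Suc N) = ?x ^ 3"
      by (simp only: power_mult [symmetric] mult.commute)
    have "(a * (1 - x)) ^ 3 - b * (1 - x ^ 3)
        = (a ^ 3 - b) * (1 - x ^ 3) + 3 * (a ^ 3 * (x ^ 2 - x))" for a b x :: "int fps"
      by (simp add: algebra_simps power2_eq_square power3_eq_cube)
    then have "Eprod 1 (Suc N) ^ 3 - Eprod 3 (Suc N)
        = (Eprod 1 N ^ 3 - Eprod 3 N) * (1 - ?x ^ 3) + 3 * (Eprod 1 N ^ 3 * (?x ^ 2 - ?x))"
      unfolding Eprod_Suc X3 mult_1 .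
    then show ?case using Suc by (simp only: dvd_add dvd_mult2 dvd_triv_left)
  qed simp
  moreover have "eq_upto n (E 1 ^ 3 - E 3) (Eprod 1 n ^ 3 - Eprod 3 n)"
    by (intro eq_upto_diff eq_upto_power E_eq_upto_Eprod) auto
  ultimately show "3 dvd fps_nth (E 1 ^ 3 - E 3) n"
    by (simp add: eq_upto_def numeral_dvd_fps_iff)
qed

section \<open>Jacobi's identity\<close>

definition triang :: "nat \<Rightarrow> nat" where
  "triang k = k * (k + 1) div 2"

lemma two_triang: "2 * triang k = k * (k + 1)"
  unfolding triang_def by (rule dvd_mult_div_cancel) simp

lemma triang_0 [simp]: "triang 0 = 0"
  by (simp add: triang_def)

lemma triang_Suc: "triang (Suc k) = triang k + Suc k"
  using two_triang[of k] two_triang[of "Suc k"] by (simp add: algebra_simps)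

lemma triang_ge: "k \<le> triang k"
  by (cases k) (simp_all add: triang_Suc)

lemma triang_mod_3: "triang k mod 3 = (if k mod 3 = 1 then 1 else 0)"
proof -
  have "2 * triang k mod 3 = (k mod 3) * ((k mod 3) + 1) mod 3"
    unfolding two_triang by (intro mod_mult_cong mod_add_cong) simp_all
  moreover have "k mod 3 = 0 \<or> k mod 3 = 1 \<or> k mod 3 = 2" by linarith
  ultimately have "2 * triang k mod 3 = (if k mod 3 = 1 then 2 else 0)"
    by (elim disjE) simp_all
  then show ?thesis by presburger
qed

lemma triang_eq_iff [simp]: "triang j = triang k \<longleftrightarrow> j = k"
proof -
  have "strict_mono triang"
    by (rule strict_monoI_Suc) (simp add: triang_Suc)
  then show ?thesis by (simp add: strict_mono_eq)
qed

text \<open>Up to the sign \<open>(-1)\<^sup>n\<close>, \<open>jac n k\<close> is the coefficient of \<open>z\<^sup>n\<^sup>-\<^sup>k\<close> in the polynomial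
  \<open>\<Prod>\<^bsub>i=1\<^esub>\<^bsup>n\<^esup>(q\<^sup>i - z) \<cdot> \<Prod>\<^bsub>i=0\<^esub>\<^bsup>n\<^esup>(1 - zq\<^sup>i)\<close>. The recurrence comes from multiplying by
  \<open>(q\<^sup>n\<^sup>+\<^sup>1 - z)(1 - zq\<^sup>n\<^sup>+\<^sup>1)\<close>, and in the case \<open>k = 0\<close> the antisymmetry of the coefficients
  replaces the coefficient with index \<open>-1\<close>.\<close>

fun jac :: "nat \<Rightarrow> nat \<Rightarrow> int fps" where
  "jac 0 k = (if k = 0 then 1 else 0)"
| "jac (Suc n) 0 = (1 + fps_X ^ (2 * Suc n)) * jac n 0 - fps_X ^ Suc n * (jac n 1 - jac n 0)"
| "jac (Suc n) (Suc k) = (1 + fps_X ^ (2 * Suc n)) * jac n (Suc k)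
     - fps_X ^ Suc n * (jac n k + jac n (Suc (Suc k)))"

lemma jac_eq_0: "n < k \<Longrightarrow> jac n k = 0"
proof (induction n arbitrary: k)
  case (Suc n)
  then show ?case by (cases k) auto
qed simp

text \<open>In terms of z, passing from n to n + 1 multiplies by 1 + p^2 - p (z + 1/z) with p =
  q^(n+1), which is (1 - p)^2 at z = 1. The last summand is the boundary term of the truncation at
  N; it vanishes for N > n.\<close>

lemma sum_jac_Suc:
  "(\<Sum>k\<le>N. (2 * of_nat k + 1) * jac (Suc n) k)
     = (1 - fps_X ^ Suc n) ^ 2 * (\<Sum>k\<le>N. (2 * of_nat k + 1) * jac n k)
       - fps_X ^ Suc n * ((2 * of_nat N + 1) * jac n (Suc N) - (2 * of_nat N + 3) * jac n N)"
proof (induction N)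
  case 0
  have "(1 + p ^ 2) * J0 - p * (J1 - J0) = (1 - p) ^ 2 * J0 - p * (J1 - 3 * J0)"
    for p J0 J1 :: "int fps"
    by (simp add: algebra_simps power2_eq_square)
  note id = this[of "fps_X ^ Suc n" "jac n 0" "jac n 1"]
  have X: "fps_X ^ (2 * Suc n) = (fps_X ^ Suc n :: int fps) ^ 2"
    by (simp only: power_mult [symmetric] mult.commute)
  have "jac (Suc n) 0 = (1 - fps_X ^ Suc n) ^ 2 * jac n 0
      - fps_X ^ Suc n * (jac n 1 - 3 * jac n 0)"
    unfolding jac.simps X by (rule id)
  then show ?case by (simp del: jac.simps power_Suc)
next
  case (Suc N)
  have X: "fps_X ^ (2 * Suc n) = (fps_X ^ Suc n :: int fps) ^ 2"
    by (simp only: power_mult [symmetric] mult.commute)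
  have "(1 - p) ^ 2 * S - p * ((2 * c + 1) * J1 - (2 * c + 3) * J0)
        + (2 * (1 + c) + 1) * ((1 + p ^ 2) * J1 - p * (J0 + J2))
      = (1 - p) ^ 2 * (S + (2 * (1 + c) + 1) * J1)
        - p * ((2 * (1 + c) + 1) * J2 - (2 * (1 + c) + 3) * J1)"
    for p S c J0 J1 J2 :: "int fps"
    by (simp add: algebra_simps power2_eq_square)
  then show ?case
    unfolding sum.atMost_Suc Suc jac.simps X of_nat_Suc .
qed

text \<open>Divide the polynomial behind \<open>jac\<close> by its factor 1 - z and put z = 1. The
  antisymmetric pair z^(-k) - z^(k+1) becomes 2k + 1, and the remaining factors pair up to a
  square.\<close>

lemma sum_jac: "(\<Sum>k\<le>n. (2 * of_nat k + 1) * jac n k) = Eprod 1 n ^ 2"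
proof (induction n)
  case (Suc n)
  have "(\<Sum>k\<le>Suc n. (2 * of_nat k + 1) * jac (Suc n) k)
      = (1 - fps_X ^ Suc n) ^ 2 * (\<Sum>k\<le>Suc n. (2 * of_nat k + 1) * jac n k)"
    unfolding sum_jac_Suc by (simp add: jac_eq_0)
  also have "(\<Sum>k\<le>Suc n. (2 * of_nat k + 1) * jac n k) = Eprod 1 n ^ 2"
    using Suc by (simp add: jac_eq_0)
  finally show ?case by (simp add: Eprod_Suc power_mult_distrib mult.commute)
qed simp

lemma ring_identity_jac:
  fixes a b x :: "'a::comm_ring_1"
  shows "(1 + (a * b) ^ 2) * ((1 - a) * (1 - x * a * b ^ 2))
      + (a * (1 - a * b ^ 2) * (1 - x * a * b ^ 2) + a * b * (x * b - a * b) * (1 - a))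
    = (1 - (a * b) ^ 2) * (1 - x * (a * b) ^ 2)"
  by (simp add: algebra_simps power2_eq_square)

text \<open>With n = k + d this says that \<open>jac n k\<close> is (-1)^k q^(k(k+1)/2) times the
  Gaussian binomial coefficient of 2n + 1 over n - k, with denominators cleared: a finite form of
  the triple product identity.\<close>

lemma jac_mult_Eprod:
  "jac (k + d) k * Eprod 1 d * Eprod 1 (k + d + k + 1)
     = (-1) ^ k * fps_X ^ triang k * Eprod 1 (2 * (k + d) + 1)"
proof (induction "k + d" arbitrary: k d)
  case 0
  then show ?case by simp
next
  case (Suc n)
  note n = \<open>Suc n = k + d\<close>
  define X :: "int fps" where "X = fps_X"
  define s where "s k = (-1) ^ k * X ^ triang k" for k
  have s_Suc: "s (Suc k) = - (X ^ Suc k * s k)" for k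
    by (simp add: s_def triang_Suc power_add)
  have E_Suc: "Eprod 1 (Suc m) = Eprod 1 m * (1 - X ^ Suc m)" for m
    by (simp add: Eprod_Suc X_def)
  have IH: "jac n k * Eprod 1 d * Eprod 1 (n + k + 1) = s k * Eprod 1 (2 * n + 1)"
    if "n = k + d" for k d
    using Suc(1)[OF that] that by (simp add: s_def X_def)
  define P Q R where "P = Eprod 1 d" and "Q = Eprod 1 (n + k + 2)" and "R = Eprod 1 (2 * n + 1)"
  \<comment> \<open>All powers below become monomials in q, a = q^d and b = q^k, which reduces the
    induction step to \<open>ring_identity_jac\<close>.\<close>
  define a b where "a = X ^ d" and "b = X ^ k"
  have ab: "X ^ Suc n = a * b"
    unfolding n a_def b_def by (simp add: power_add)
  have ab2: "X ^ (2 * Suc n) = (a * b) ^ 2"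
    unfolding ab [symmetric] by (simp only: power_mult [symmetric] mult.commute)
  have abb: "X ^ (n + k + 1) = a * b ^ 2" "X ^ (n + k + 2) = X * a * b ^ 2"
  proof -
    have "n + k + 1 = d + 2 * k" "n + k + 2 = Suc (d + 2 * k)" using n by simp_all
    then show "X ^ (n + k + 1) = a * b ^ 2" "X ^ (n + k + 2) = X * a * b ^ 2"
      by (simp_all only: a_def b_def power_add power_mult [symmetric] power_Suc mult_ac)
  qed
  have Q: "Q = Eprod 1 (n + k + 1) * (1 - X * a * b ^ 2)"
    "Q = Eprod 1 (n + k) * (1 - a * b ^ 2) * (1 - X * a * b ^ 2)"
    using E_Suc[of "n + k + 1"] E_Suc[of "n + k"] abb by (simp_all add: Q_def)
  have A: "jac n k * P * Q = s k * R * ((1 - a) * (1 - X * a * b ^ 2))"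
  proof (cases d)
    case 0
    then show ?thesis using n by (simp add: jac_eq_0 a_def)
  next
    case (Suc e)
    have "jac n k * P * Q
        = (jac n k * Eprod 1 e * Eprod 1 (n + k + 1)) * (1 - a) * (1 - X * a * b ^ 2)"
      unfolding Q(1) P_def Suc E_Suc a_def by (simp only: mult_ac)
    also have "jac n k * Eprod 1 e * Eprod 1 (n + k + 1) = s k * R"
      unfolding R_def using n Suc by (intro IH) simp
    finally show ?thesis by (simp only: mult_ac)
  qed
  \<comment> \<open>The induction hypothesis covers index \<open>Suc k\<close> only for d \<ge> 2.
    For d = 0 the factor 1 - a vanishes, for d = 1 the factor X * b - a * b, matching
    \<open>jac n (Suc k) = 0\<close>.\<close>
  have C: "X ^ Suc n * (jac n (Suc k) * P * Q) = - (s k * R * (a * b * (X * b - a * b) * (1 - a)))"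
  proof (cases d)
    case 0
    then show ?thesis using n by (simp add: jac_eq_0 a_def)
  next
    case (Suc e)
    show ?thesis
    proof (cases e)
      case 0
      then have "jac n (Suc k) = 0" "a = X" using n Suc by (simp_all add: jac_eq_0 a_def)
      then show ?thesis by (simp add: algebra_simps)
    next
      case e: (Suc f)
      have "jac n (Suc k) * P * Q
          = (jac n (Suc k) * Eprod 1 f * Eprod 1 (n + Suc k + 1)) * (1 - X ^ e) * (1 - a)"
        unfolding Q_def P_def Suc E_Suc a_def e by (simp add: mult_ac del: power_Suc)
      also have "jac n (Suc k) * Eprod 1 f * Eprod 1 (n + Suc k + 1) = s (Suc k) * R"
        unfolding R_def using n Suc e by (intro IH) simp
      finally have 1: "jac n (Suc k) * P * Q = s (Suc k) * R * (1 - X ^ e) * (1 - a)" .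
      have a: "a = X * X ^ e" by (simp add: a_def Suc)
      show ?thesis
        unfolding 1 s_Suc ab unfolding a b_def by (simp add: algebra_simps)
    qed
  qed
  have PE: "Eprod 1 (2 * Suc n + 1) = R * (1 - (a * b) ^ 2) * (1 - X * (a * b) ^ 2)"
    using E_Suc[of "2 * n + 1"] E_Suc[of "2 * n + 2"] ab2 by (simp add: R_def)
  \<comment> \<open>J is the left neighbour in the recurrence: \<open>jac n j\<close> if k =
    \<open>Suc j\<close>, and \<open>- jac n 0\<close> if k = 0, by antisymmetry.\<close>
  have comb: "((1 + X ^ (2 * Suc n)) * jac n k - X ^ Suc n * (J + jac n (Suc k))) * P * Q
      = s k * Eprod 1 (2 * Suc n + 1)"
    if B: "X ^ Suc n * (J * P * Q) = - (s k * R * (a * (1 - a * b ^ 2) * (1 - X * a * b ^ 2)))"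
    for J
  proof -
    have "((1 + X ^ (2 * Suc n)) * jac n k - X ^ Suc n * (J + jac n (Suc k))) * P * Q
      = (1 + X ^ (2 * Suc n)) * (jac n k * P * Q) - X ^ Suc n * (J * P * Q)
         - X ^ Suc n * (jac n (Suc k) * P * Q)"
      by (simp only: ring_distribs mult_ac diff_diff_eq)
    also have "\<dots> = s k * R * ((1 + (a * b) ^ 2) * ((1 - a) * (1 - X * a * b ^ 2))
      + (a * (1 - a * b ^ 2) * (1 - X * a * b ^ 2) + a * b * (X * b - a * b) * (1 - a)))"
      unfolding A B C ab2 by (simp only: ring_distribs mult_ac) simp
    also have "\<dots> = s k * Eprod 1 (2 * Suc n + 1)"
      unfolding ring_identity_jac PE by (simp only: mult_ac)
    finally show ?thesis .
  qed
  have "jac (Suc n) k * P * Q = s k * Eprod 1 (2 * Suc n + 1)"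
  proof (cases k)
    case 0
    have d: "d = Suc n" using n 0 by simp
    have "jac n 0 * P * Q = (jac n 0 * Eprod 1 n * Eprod 1 (n + 0 + 1)) * (1 - a) * (1 - X * a)"
      using Q(1) unfolding P_def d E_Suc a_def 0 b_def by (simp add: mult_ac del: power_Suc)
    also have "jac n 0 * Eprod 1 n * Eprod 1 (n + 0 + 1) = s 0 * R"
      unfolding R_def by (intro IH) simp
    finally have "X ^ Suc n * (- jac n 0 * P * Q)
        = - (s k * R * (a * (1 - a * b ^ 2) * (1 - X * a * b ^ 2)))"
      unfolding ab by (simp add: 0 b_def mult_ac)
    from comb[OF this] show ?thesis by (simp add: 0 X_def algebra_simps)
  next
    case (Suc j)
    have "jac n j * P * Q
        = (jac n j * P * Eprod 1 (n + j + 1)) * (1 - a * b ^ 2) * (1 - X * a * b ^ 2)"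
      using Q(2) by (simp add: Suc mult_ac)
    also have "jac n j * P * Eprod 1 (n + j + 1) = s j * R"
      unfolding R_def P_def using n Suc by (intro IH) simp
    finally have 1: "jac n j * P * Q = s j * R * (1 - a * b ^ 2) * (1 - X * a * b ^ 2)" .
    have "X ^ Suc n * (jac n j * P * Q)
        = - (s k * R * (a * (1 - a * b ^ 2) * (1 - X * a * b ^ 2)))"
      unfolding 1 ab Suc s_Suc b_def by (simp add: mult_ac)
    from comb[OF this] show ?thesis by (simp add: Suc X_def)
  qed
  then show ?case
    unfolding s_def P_def Q_def n [symmetric] X_def by simp
qed

section \<open>Passage to the limit in Jacobi's identity\<close>

lemma fps_unit_exists:
  fixes F :: "'a::comm_ring_1 fps"
  assumes "fps_nth F 0 = 1"
  obtains G where "F * G = 1"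
  using fps_left_inverse[of 1 F] assms by (metis mult.commute mult_1)

lemma eq_upto_inverse:
  fixes F G F' G' :: "'a::comm_ring_1 fps"
  assumes "eq_upto n F G" "F * F' = 1" "G * G' = 1"
  shows "eq_upto n F' G'"
proof -
  have "eq_upto n (F' * (G * G')) (F' * (F * G'))"
    using assms(1) by (intro eq_upto_mult eq_upto_refl) (rule eq_upto_sym)
  moreover have "F' * (F * G') = (F * F') * G'" by (simp only: mult_ac)
  ultimately show ?thesis using assms by simp
qed

text \<open>The Gaussian binomial coefficient tends to 1/E(q). It is correct only up to order d = n
  - k, but the factor q^(triang k) with \<open>triang k\<close> \<ge> k raises this to order
  n.\<close>

lemma jac_mult_E:
  assumes "k \<le> n"
  shows "eq_upto n (jac n k * E 1) ((-1) ^ k * fps_X ^ triang k)"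
proof -
  define d where "d = n - k"
  have n: "n = k + d" using assms by (simp add: d_def)
  have Ep: "eq_upto d (Eprod 1 m) (E 1)" if "d \<le> m" for m
    using that by (intro eq_upto_sym[OF E_eq_upto_Eprod]) auto
  have Ep0: "fps_nth (Eprod 1 m) 0 = 1" for m
    by (induction m) (simp_all add: Eprod_Suc)
  obtain U where U: "Eprod 1 d * U = 1" using fps_unit_exists[OF Ep0] .
  obtain W where W: "Eprod 1 (k + d + k + 1) * W = 1" using fps_unit_exists[OF Ep0] .
  obtain I where I: "E 1 * I = 1" using fps_unit_exists[OF E_has_prod(2)] by auto
  have UI: "eq_upto d U I" by (rule eq_upto_inverse[OF Ep U I]) simp
  have WI: "eq_upto d W I" by (rule eq_upto_inverse[OF Ep W I]) simp
  have "jac n k * E 1 = jac n k * (Eprod 1 d * U) * (Eprod 1 (k + d + k + 1) * W) * E 1"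
    by (simp only: U W mult_1_right)
  also have "\<dots> = (jac (k + d) k * Eprod 1 d * Eprod 1 (k + d + k + 1)) * U * W * E 1"
    unfolding n by (simp only: mult_ac)
  also have "\<dots> = fps_X ^ triang k * ((-1) ^ k * Eprod 1 (2 * (k + d) + 1) * U * W * E 1)"
    unfolding jac_mult_Eprod by (simp only: mult_ac)
  finally have 1: "jac n k * E 1
      = fps_X ^ triang k * ((-1) ^ k * Eprod 1 (2 * (k + d) + 1) * U * W * E 1)" .
  have "eq_upto d ((-1) ^ k * Eprod 1 (2 * (k + d)
      + 1) * U * W * E 1) ((-1) ^ k * E 1 * I * I * E 1)"
    using UI WI by (intro eq_upto_mult eq_upto_refl Ep) auto
  moreover have "(-1) ^ k * E 1 * I * I * E 1 = (-1) ^ k * (E 1 * I) * (E 1 * I)"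
    by (simp only: mult_ac)
  ultimately have "eq_upto (triang k + d) (jac n k * E 1) (fps_X ^ triang k * (-1) ^ k)"
    unfolding 1 by (intro eq_upto_X_power_mult) (simp only: I mult_1_right)
  then have "eq_upto n (jac n k * E 1) (fps_X ^ triang k * (-1) ^ k)"
    by (rule eq_upto_mono) (use triang_ge[of k] n in simp)
  then show ?thesis by (simp only: mult.commute)
qed

text \<open>In E^2 * E the square is expanded by \<open>sum_jac\<close>, and the remaining factor E
  turns every \<open>jac n k\<close> into a signed power of q, up to order n. Indices k > n cannot
  contribute because \<open>triang k\<close> \<ge> k.\<close>

lemma E_1_cubed_nth:
  "fps_nth (E 1 ^ 3) n = (\<Sum>k\<le>n. if triang k = n then (-1) ^ k * (2 * int k + 1) else 0)"
proof -
  have "eq_upto n (E 1 ^ 2 * E 1) (Eprod 1 n ^ 2 * E 1)"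
    by (intro eq_upto_mult eq_upto_power eq_upto_refl E_eq_upto_Eprod) auto
  moreover have "Eprod 1 n ^ 2 * E 1 = (\<Sum>k\<le>n. (2 * of_nat k + 1) * (jac n k * E 1))"
    unfolding sum_jac [symmetric] sum_distrib_right by (simp only: mult.assoc)
  moreover have "eq_upto n (\<Sum>k\<le>n. (2 * of_nat k + 1) * (jac n k * E 1))
      (\<Sum>k\<le>n. (2 * of_nat k + 1) * ((-1) ^ k * fps_X ^ triang k))"
    by (intro eq_upto_sum eq_upto_mult eq_upto_refl jac_mult_E) simp
  ultimately have "eq_upto n (E 1 ^ 2 * E 1)
      (\<Sum>k\<le>n. (2 * of_nat k + 1) * ((-1) ^ k * fps_X ^ triang k))"
    by (auto simp add: eq_upto_def simp del: One_nat_def)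
  then have "fps_nth (E 1 ^ 2 * E 1) n
      = (\<Sum>k\<le>n. fps_nth ((2 * of_nat k + 1) * ((-1) ^ k * fps_X ^ triang k)) n)"
    by (simp add: eq_upto_def fps_sum_nth)
  also have "\<dots> = (\<Sum>k\<le>n. if triang k = n then (-1) ^ k * (2 * int k + 1) else 0)"
  proof (intro sum.cong refl)
    fix k
    have "(-1) ^ k = fps_const ((-1) ^ k :: int)"
      by (induction k) simp_all
    moreover have "2 * of_nat k + 1 = (of_nat (2 * k + 1) :: int fps)"
      by simp
    ultimately have "(2 * of_nat k + 1) * ((-1) ^ k * fps_X ^ triang k)
        = fps_const (int (2 * k + 1)) * (fps_const ((-1) ^ k) * fps_X ^ triang k)"
      by (simp only: fps_of_nat)
    then show "fps_nth ((2 * of_nat k + 1) * ((-1) ^ k * fps_X ^ triang k)) n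
        = (if triang k = n then (-1) ^ k * (2 * int k + 1) else 0)"
      by (simp only: fps_mult_left_const_nth fps_X_power_nth) simp
  qed
  finally show ?thesis by (simp add: eval_nat_numeral mult_ac)
qed

lemma E_1_cubed_nth_triang: "fps_nth (E 1 ^ 3) (triang k) = (-1) ^ k * (2 * int k + 1)"
  using triang_ge[of k] unfolding E_1_cubed_nth by simp

lemma E_1_cubed_nth_not_triang: "n \<notin> range triang \<Longrightarrow> fps_nth (E 1 ^ 3) n = 0"
  unfolding E_1_cubed_nth by (auto intro!: sum.neutral)

lemma sect_2_E_1_cubed: "sect 3 2 (E 1 ^ 3) = 0"
proof (rule fps_ext)
  fix n
  have "3 * n + 2 \<noteq> triang k" for k
    using triang_mod_3[of k] by presburger
  then show "fps_nth (sect 3 2 (E 1 ^ 3)) n = fps_nth 0 n"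
    by (auto intro!: E_1_cubed_nth_not_triang simp del: One_nat_def)
qed

lemma triang_3_1: "triang (3 * j + 1) = 9 * triang j + 1"
  using two_triang[of "3 * j + 1"] two_triang[of j] by (simp add: algebra_simps)

text \<open>A triangular number congruent to 1 modulo 3 has index k = 3j + 1 and equals 9
  \<open>triang j\<close> + 1, while its coefficient (-1)^k (2k + 1) is -3 times (-1)^j (2j +
  1).\<close>

lemma sect_1_E_1_cubed: "sect 3 1 (E 1 ^ 3) = - 3 * E 3 ^ 3"
proof (rule fps_ext)
  fix n
  have E3: "E 3 ^ 3 = E 1 ^ 3 oo fps_X ^ 3"
    using E_compose[of 1 3] by (simp add: fps_compose_X_power_ring_simps)
  show "fps_nth (sect 3 1 (E 1 ^ 3)) n = fps_nth (- 3 * E 3 ^ 3) n"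
  proof (cases "3 * n + 1 \<in> range triang")
    case True
    then obtain k where k: "3 * n + 1 = triang k" by auto
    then have "k mod 3 = 1"
      using triang_mod_3[of k] by presburger
    then obtain j where j: "k = 3 * j + 1" by (metis mult_div_mod_eq)
    have n: "n = 3 * triang j" using k unfolding j triang_3_1 by simp
    have "fps_nth (sect 3 1 (E 1 ^ 3)) n = (-1) ^ k * (2 * int k + 1)"
      using k by (simp add: E_1_cubed_nth_triang del: One_nat_def)
    also have "\<dots> = - 3 * ((-1) ^ j * (2 * int j + 1))"
      by (simp add: j power_mult)
    also have "\<dots> = fps_nth (- 3 * E 3 ^ 3) n"
      unfolding E3 n by (simp add: fps_nth_compose_X_power E_1_cubed_nth_triang numeral_fps_const
          del: One_nat_def)
    finally show ?thesis .
  next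
    case False
    have "fps_nth (E 3 ^ 3) n = 0"
    proof (cases "3 dvd n")
      case True
      then obtain m where m: "n = 3 * m" by auto
      have "m \<noteq> triang j" for j
      proof
        assume "m = triang j"
        then have "3 * n + 1 = triang (3 * j + 1)" unfolding triang_3_1 by (simp add: m)
        then show False using False by (metis rangeI)
      qed
      then have "fps_nth (E 1 ^ 3) m = 0" by (intro E_1_cubed_nth_not_triang) auto
      then show ?thesis by (simp add: E3 m fps_nth_compose_X_power)
    qed (simp add: E3 fps_nth_compose_X_power)
    then show ?thesis using False
      by (simp add: E_1_cubed_nth_not_triang numeral_fps_const del: One_nat_def)
  qed
qed

section \<open>The operator extracting exponents divisible by 3\<close>

definition E_inv :: "nat \<Rightarrow> int fps" where
  "E_inv r = fps_left_inverse (E r) 1"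

lemma E_E_inv: "r > 0 \<Longrightarrow> E r * E_inv r = 1"
  using fps_left_inverse[of 1 "E r"] by (simp add: E_inv_def E_has_prod(2) mult.commute)

lemma E_neq_0: "r > 0 \<Longrightarrow> E r \<noteq> 0"
  using E_E_inv[of r] by auto

lemma E_power_E_inv_power: "r > 0 \<Longrightarrow> E r ^ (m + k) * E_inv r ^ k = E r ^ m"
  by (simp add: power_add mult.assoc E_E_inv flip: power_mult_distrib)

lemma E_inv_power_E_power: "r > 0 \<Longrightarrow> E_inv r ^ (m + k) * E r ^ k = E_inv r ^ m"
  by (simp add: power_add mult.assoc mult.commute[of "E_inv r"] E_E_inv flip: power_mult_distrib)

lemma E_inv_compose:
  assumes "r > 0" "s > 0"
  shows "E_inv r oo fps_X ^ s = E_inv (r * s)"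
proof -
  have "E (r * s) * (E_inv r oo fps_X ^ s) = (E r * E_inv r) oo fps_X ^ s"
    using assms by (simp add: E_compose fps_compose_X_power_ring_simps)
  also have "\<dots> = E (r * s) * E_inv (r * s)"
    using assms by (simp add: E_E_inv fps_compose_X_power_ring_simps)
  finally show ?thesis using E_neq_0[of "r * s"] assms by simp
qed

lemma sect_numeral_mult: "sect m r (numeral k * F :: int fps) = numeral k * sect m r F"
  by (simp add: fps_eq_iff numeral_fps_const)

lemma sect_numeral_power_mult:
  "sect m r (numeral k ^ j * F :: int fps) = numeral k ^ j * sect m r F"
  by (induction j) (simp_all add: mult.assoc sect_numeral_mult)

lemma sect_of_int_mult: "sect m r (of_int c * F :: int fps) = of_int c * sect m r F"
  by (simp add: fps_eq_iff flip: fps_of_int)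

lemma sect_X_power_mult_compose:
  fixes G :: "'a::idom fps"
  assumes "r < 3" "s < 3"
  shows "sect 3 r (fps_X ^ s * (G oo fps_X ^ 3)) = (if r = s then G else 0)"
proof -
  have "sect 3 r (fps_X ^ s :: 'a fps) = (if r = s then 1 else 0)"
    using assms by (auto simp: fps_eq_iff fps_X_power_nth)
  then show ?thesis using assms(1) by (simp add: sect_mult_compose)
qed

lemmas compose_X_cubed = fps_compose_X_power_ring_simps[where m = 3, OF zero_less_numeral]

section \<open>The 3-dissection of E(q)^3 and the cubic relation\<close>

definition E_cubed_sect :: "int fps" where
  "E_cubed_sect = sect 3 0 (E 1 ^ 3)"

lemma E_1_cubed_dissect: "E 1 ^ 3 = (E_cubed_sect oo fps_X ^ 3) - 3 * (fps_X * E 9 ^ 3)"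
proof -
  have "E 9 ^ 3 = E 3 ^ 3 oo fps_X ^ 3"
    using E_compose[of 3 3] by (simp add: fps_compose_X_power_ring_simps)
  then show ?thesis
    using fps_three_sections[of "E 1 ^ 3"]
    unfolding sect_1_E_1_cubed sect_2_E_1_cubed E_cubed_sect_def [symmetric]
    by (simp add: fps_compose_X_power_ring_simps fps_compose_uminus)
qed

definition E_cubed_norm :: "int fps" where
  "E_cubed_norm = E_cubed_sect ^ 3 - 27 * (fps_X * E 3 ^ 9)"

lemma E_cubed_norm_eq: "E_cubed_norm = E 1 ^ 12 * E_inv 3 ^ 3"
proof -
  have "norm3 (E 1 ^ 3) = E_cubed_norm"
    unfolding norm3_def sect_1_E_1_cubed sect_2_E_1_cubed E_cubed_sect_def [symmetric]
        E_cubed_norm_def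
    by (simp add: power_mult_distrib power_mult [symmetric] algebra_simps)
  then have "E_cubed_norm * E 3 ^ 3 = (norm3 (E 1) * E 3) ^ 3"
    by (simp only: norm3_power power_mult_distrib)
  also have "\<dots> = E 1 ^ 12"
    unfolding norm3_E by (simp flip: power_mult)
  finally have "E_cubed_norm * E 3 ^ 3 = E 1 ^ 12" .
  then have "E 1 ^ 12 * E_inv 3 ^ 3 = E_cubed_norm * (E 3 ^ 3 * E_inv 3 ^ 3)"
    by (metis mult.assoc)
  then show ?thesis
    using E_power_E_inv_power[of 3 0 3] by (simp only: add_0 power_0 mult_1_right zero_less_numeral)
qed

lemma E_cubed_norm_neq_0: "E_cubed_norm \<noteq> 0"
  using E_neq_0[of 1] E_E_inv[of 3] by (auto simp: E_cubed_norm_eq)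

definition haupt :: "int fps" where
  "haupt = 27 * (fps_X * E 3 ^ 12 * E_inv 1 ^ 12)"

lemma haupt_mult_E_cubed_norm: "haupt * E_cubed_norm = 27 * (fps_X * E 3 ^ 9)"
proof -
  have "haupt * E_cubed_norm
      = 27 * (fps_X * (E 3 ^ (9 + 3) * E_inv 3 ^ 3) * (E 1 ^ (0 + 12) * E_inv 1 ^ 12))"
    by (simp add: haupt_def E_cubed_norm_eq mult_ac)
  also have "\<dots> = 27 * (fps_X * E 3 ^ 9)"
    by (subst (1 2) E_power_E_inv_power) simp_all
  finally show ?thesis .
qed

lemma haupt_neq_0: "haupt \<noteq> 0"
  using haupt_mult_E_cubed_norm E_neq_0[of 3] by auto

definition cubic_quot :: "int fps" where
  "cubic_quot = 3 * (fps_X * E 9 ^ 3 * E_inv 1 ^ 3)"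

text \<open>Write v = 3g/(a - 3g), where a - 3g = E(q)^3. Multiplication by a^3 - 27 g^3 clears the
  denominator and leaves a polynomial in a and g, whose sections can be read off. For the cubic
  relation, put I = 1/(a - 3g); then a I = 1 + v and 3 g I = v, so (a^3 - 27 g^3) I^3 = (1 + v)^3 -
  v^3.\<close>

lemma cubic_quot_E_cubed_norm:
  "cubic_quot * (E_cubed_norm oo fps_X ^ 3)
      = 3 * (fps_X * E 9 ^ 3) * ((E_cubed_sect oo fps_X ^ 3) ^ 2
     + 3 * (E_cubed_sect oo fps_X ^ 3) * (fps_X * E 9 ^ 3) + 9 * (fps_X * E 9 ^ 3) ^ 2)"
  and cubic_quot_cubed: "cubic_quot ^ 3
      = (1 + 3 * cubic_quot + 3 * cubic_quot ^ 2) * (haupt oo fps_X ^ 3)"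
proof -
  define g a F I where "g = fps_X * E 9 ^ 3" and "a = E_cubed_sect oo fps_X ^ 3"
    and "F = E 1 ^ 3" and "I = E_inv 1 ^ 3"
  have E9: "E 3 oo fps_X ^ 3 = E 9"
    using E_compose[of 3 3] by simp
  have F: "F = a - 3 * g"
    unfolding F_def a_def g_def by (rule E_1_cubed_dissect)
  have FI: "(a - 3 * g) * I = 1"
    using E_power_E_inv_power[of 1 0 3] unfolding F [symmetric] F_def I_def by simp
  have D': "E_cubed_norm oo fps_X ^ 3 = a ^ 3 - 27 * g ^ 3"
    unfolding E_cubed_norm_def compose_X_cubed E9
        by (simp add: a_def g_def power_mult_distrib flip: power_mult)
  have TD': "(haupt oo fps_X ^ 3) * (E_cubed_norm oo fps_X ^ 3) = 27 * g ^ 3"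
    unfolding compose_X_cubed(3) [symmetric] haupt_mult_E_cubed_norm unfolding compose_X_cubed E9
    by (simp add: g_def power_mult_distrib flip: power_mult)
  have cubic_quot: "cubic_quot = 3 * g * I"
    by (simp add: cubic_quot_def g_def I_def mult_ac)
  have "cubic_quot * (E_cubed_norm oo fps_X ^ 3)
      = 3 * g * (a ^ 2 + 3 * a * g + 9 * g ^ 2) * ((a - 3 * g) * I)"
    unfolding cubic_quot D' by (simp add: algebra_simps power2_eq_square power3_eq_cube)
  then show vD: "cubic_quot * (E_cubed_norm oo fps_X ^ 3)
      = 3 * (fps_X * E 9 ^ 3) * ((E_cubed_sect oo fps_X ^ 3) ^ 2
     + 3 * (E_cubed_sect oo fps_X ^ 3) * (fps_X * E 9 ^ 3) + 9 * (fps_X * E 9 ^ 3) ^ 2)"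
    unfolding FI by (simp add: g_def a_def)
  have "(a ^ 3 - 27 * g ^ 3) * I ^ 3
      = ((a - 3 * g) * I) ^ 3 + 3 * cubic_quot * ((a - 3 * g) * I) ^ 2 + 3 * cubic_quot ^ 2 * ((a
          - 3 * g) * I)"
    unfolding cubic_quot by (simp add: algebra_simps power2_eq_square power3_eq_cube)
  then have D'I: "(E_cubed_norm oo fps_X ^ 3) * I ^ 3 = 1 + 3 * cubic_quot + 3 * cubic_quot ^ 2"
    unfolding FI D' by simp
  have "cubic_quot ^ 3 = (27 * g ^ 3) * I ^ 3"
    unfolding cubic_quot by (simp add: power_mult_distrib)
  also have "\<dots> = ((E_cubed_norm oo fps_X ^ 3) * I ^ 3) * (haupt oo fps_X ^ 3)"
    unfolding TD' [symmetric] by (simp only: mult_ac)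
  finally show "cubic_quot ^ 3 = (1 + 3 * cubic_quot + 3 * cubic_quot ^ 2) * (haupt oo fps_X ^ 3)"
    unfolding D'I .
qed

text \<open>This is the cubic relation times v^k; T(q^3) leaves the extraction as T.\<close>

lemma sect_cubic_quot_power_add_3:
  "sect 3 0 (cubic_quot ^ (k + 3))
     = haupt * (sect 3 0 (cubic_quot ^ k) + 3 * sect 3 0 (cubic_quot ^ (k + 1))
         + 3 * sect 3 0 (cubic_quot ^ (k + 2)))"
proof -
  have "cubic_quot ^ (k + 3)
      = (cubic_quot ^ k + 3 * cubic_quot ^ (k + 1) + 3 * cubic_quot ^ (k
          + 2)) * (haupt oo fps_X ^ 3)"
    unfolding power_add cubic_quot_cubed by (simp add: algebra_simps)
  then have "sect 3 0 (cubic_quot ^ (k + 3))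
      = sect 3 0 (cubic_quot ^ k + 3 * cubic_quot ^ (k + 1) + 3 * cubic_quot ^ (k + 2)) * haupt"
    by (simp only: sect_mult_compose zero_less_numeral)
  then show ?thesis
    by (simp only: sect_add sect_numeral_mult mult.commute)
qed

lemma sect_cubic_quot_0: "sect 3 0 (cubic_quot ^ 0) = 1"
  by (simp add: fps_eq_iff)

text \<open>Since a is a series in q^3 and g is q times one, only the term 27 g^3 of the cleared
  numerator has exponents divisible by 3.\<close>

lemma sect_cubic_quot_1: "sect 3 0 (cubic_quot ^ 1) = haupt"
proof -
  have E9: "E 9 = E 3 oo fps_X ^ 3"
    using E_compose[of 3 3] by simp
  have "cubic_quot * (E_cubed_norm oo fps_X ^ 3)
      = fps_X ^ 1 * (3 * (E 3 ^ 3 * E_cubed_sect ^ 2) oo fps_X ^ 3)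
          + fps_X ^ 2 * (9 * (E 3 ^ 6 * E_cubed_sect) oo fps_X ^ 3)
        + fps_X ^ 0 * (27 * (fps_X * E 3 ^ 9) oo fps_X ^ 3)"
    unfolding cubic_quot_E_cubed_norm E9 compose_X_cubed
    by (simp add: algebra_simps power_mult_distrib power2_eq_square power3_eq_cube eval_nat_numeral)
  then have "sect 3 0 cubic_quot * E_cubed_norm = 27 * (fps_X * E 3 ^ 9)"
    by (simp only: sect_mult_compose [symmetric] sect_add sect_X_power_mult_compose) simp
  then show ?thesis
    using haupt_mult_E_cubed_norm E_cubed_norm_neq_0 by (metis mult_right_cancel power_one_right)
qed

text \<open>In the squared numerator only 54 a^3 g^3 + 729 g^6 survives. Replacing a^3 by the norm
  plus 27 g^3 and dividing by the squared norm gives the stated polynomial in T.\<close>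

lemma sect_cubic_quot_2: "sect 3 0 (cubic_quot ^ 2) = 2 * haupt + 3 * haupt ^ 2"
proof -
  have E9: "E 9 = E 3 oo fps_X ^ 3"
    using E_compose[of 3 3] by simp
  define e where "e = E 3 ^ 3"
  have E9e: "E 9 ^ 3 = e oo fps_X ^ 3"
    unfolding E9 e_def by (simp add: fps_compose_X_power_ring_simps)
  have "(3 * (x * c) * (b ^ 2 + 3 * b * (x * c) + 9 * (x * c) ^ 2)) ^ 2
      = x ^ 2 * (9 * (c ^ 2 * b ^ 4) + 486 * (c ^ 5 * b * x ^ 3))
        + x ^ 1 * (243 * (c ^ 4 * b ^ 2 * x ^ 3))
        + x ^ 0 * (54 * (b ^ 3 * (x ^ 3 * c ^ 3)) + 729 * (x ^ 3 * c ^ 3) ^ 2)"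
    for x b c :: "int fps"
    by (simp add: algebra_simps eval_nat_numeral)
  from this[of fps_X "e oo fps_X ^ 3" "E_cubed_sect oo fps_X ^ 3"]
  have "cubic_quot ^ 2 * (E_cubed_norm ^ 2 oo fps_X ^ 3)
      = fps_X ^ 2 * ((9 * (e ^ 2 * E_cubed_sect ^ 4)
          + 486 * (e ^ 5 * E_cubed_sect * fps_X)) oo fps_X ^ 3)
        + fps_X ^ 1 * (243 * (e ^ 4 * E_cubed_sect ^ 2 * fps_X) oo fps_X ^ 3)
        + fps_X ^ 0 * ((54 * (E_cubed_sect ^ 3 * (fps_X * e ^ 3))
            + 729 * (fps_X * e ^ 3) ^ 2) oo fps_X ^ 3)"
    unfolding compose_X_cubed power_mult_distrib [symmetric, of cubic_quot] cubic_quot_E_cubed_norm E9e .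
  then have "sect 3 0 (cubic_quot ^ 2) * E_cubed_norm ^ 2
      = 54 * (E_cubed_sect ^ 3 * (fps_X * e ^ 3)) + 729 * (fps_X * e ^ 3) ^ 2"
    by (simp only: sect_mult_compose [symmetric] sect_add sect_X_power_mult_compose) simp
  also have "\<dots>
      = 2 * (E_cubed_norm + 27 * (fps_X * E 3 ^ 9)) * (27 * (fps_X * E 3 ^ 9))
          + (27 * (fps_X * E 3 ^ 9)) ^ 2"
    by (simp add: E_cubed_norm_def e_def algebra_simps flip: power_mult)
  also have "\<dots> = (2 * haupt + 3 * haupt ^ 2) * E_cubed_norm ^ 2"
    unfolding haupt_mult_E_cubed_norm [symmetric] by (simp add: algebra_simps power2_eq_square)
  finally show ?thesis using E_cubed_norm_neq_0 by simp
qed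

section \<open>The ring Z[T] under the extraction\<close>

text \<open>Z[T], generated by adding monomials, so that statements about \<open>sect\<close> can be
  proved one monomial at a time.\<close>

inductive_set haupt_poly :: "int fps set" where
  zero: "0 \<in> haupt_poly"
| monom: "f \<in> haupt_poly \<Longrightarrow> of_int c * haupt ^ i + f \<in> haupt_poly"

lemma haupt_poly_add: "f \<in> haupt_poly \<Longrightarrow> g \<in> haupt_poly \<Longrightarrow> f + g \<in> haupt_poly"
  by (induction f rule: haupt_poly.induct) (auto simp: add.assoc intro: haupt_poly.intros)

lemma haupt_poly_haupt_power_mult: "f \<in> haupt_poly \<Longrightarrow> of_int c * haupt ^ j * f \<in> haupt_poly"
proof (induction f rule: haupt_poly.induct)
  case (monom f d i)
  have "of_int c * haupt ^ j * (of_int d * haupt ^ i + f)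
      = of_int (c * d) * haupt ^ (j + i) + of_int c * haupt ^ j * f"
    by (simp add: algebra_simps power_add)
  then show ?case using monom by (simp only: haupt_poly.monom)
qed (simp add: haupt_poly.zero)

lemma haupt_poly_mult_haupt: "f \<in> haupt_poly \<Longrightarrow> haupt * f \<in> haupt_poly"
  using haupt_poly_haupt_power_mult[of f 1 1] by simp

lemma haupt_poly_of_int_mult: "f \<in> haupt_poly \<Longrightarrow> of_int c * f \<in> haupt_poly"
  using haupt_poly_haupt_power_mult[of f c 0] by simp

lemma haupt_poly_haupt_power: "haupt ^ i \<in> haupt_poly"
  using haupt_poly.monom[OF haupt_poly.zero, of 1 i] by simp

lemma haupt_poly_const_mod_27:
  assumes "f \<in> haupt_poly"
  obtains c where "27 dvd f - of_int c"
proof -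
  have haupt: "27 dvd haupt" by (simp add: haupt_def)
  from assms have "\<exists>c. 27 dvd f - of_int c"
  proof (induction f rule: haupt_poly.induct)
    case zero
    show ?case by (rule exI[of _ 0]) simp
  next
    case (monom f d i)
    then obtain c where c: "27 dvd f - of_int c" by blast
    show ?case
    proof (cases i)
      case 0
      have "27 dvd of_int d * haupt ^ i + f - of_int (d + c)" using c by (simp add: 0)
      then show ?thesis by blast
    next
      case (Suc j)
      have "27 dvd of_int d * haupt ^ i + (f - of_int c)"
        using haupt c by (simp add: Suc)
      then have "27 dvd of_int d * haupt ^ i + f - of_int c" by (simp add: add_diff_eq)
      then show ?thesis by blast
    qed
  qed
  then show ?thesis using that by blast
qed

text \<open>The hypothesis allows j up to k/3 rounded up. The initial values 1, T, 2T + 3T^2 attain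
  this bound, and the recurrence adds one factor T whenever k grows by 3.\<close>

lemma sect_cubic_quot_power:
  assumes "3 * j \<le> k + 2"
  shows "\<exists>h\<in>haupt_poly. sect 3 0 (cubic_quot ^ k) = haupt ^ j * h"
  using assms
proof (induction k arbitrary: j rule: less_induct)
  case (less k)
  have "k = 0 \<or> k = 1 \<or> k = 2 \<or> k = (k - 3) + 3" by linarith
  then consider "k = 0" | "k = 1" | "k = 2" | m where "k = m + 3" by metis
  then show ?case
  proof cases
    case 1
    then have "j = 0" using less.prems by simp
    then show ?thesis using 1 haupt_poly_haupt_power[of 0] sect_cubic_quot_0 by auto
  next
    case 2
    then have "j = 0 \<or> j = 1" using less.prems by auto
    then show ?thesis
        using 2 sect_cubic_quot_1 haupt_poly_haupt_power[of 0] haupt_poly_haupt_power[of 1] by auto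
  next
    case 3
    have T2: "2 + 3 * haupt \<in> haupt_poly" "2 * haupt + 3 * haupt ^ 2 \<in> haupt_poly"
      using haupt_poly_add[OF haupt_poly_of_int_mult[OF haupt_poly_haupt_power, of 2 0]
          haupt_poly_of_int_mult[OF haupt_poly_haupt_power, of 3 1]]
        haupt_poly_add[OF haupt_poly_of_int_mult[OF haupt_poly_haupt_power, of 2 1]
            haupt_poly_of_int_mult[OF haupt_poly_haupt_power, of 3 2]]
      by simp_all
    have "j = 0 \<or> j = 1" using 3 less.prems by auto
    then show ?thesis
    proof
      assume "j = 1"
      then show ?thesis using T2(1) 3 sect_cubic_quot_2
        by (intro bexI[of _ "2 + 3 * haupt"]) (simp_all add: algebra_simps power2_eq_square)
    qed (use T2(2) 3 sect_cubic_quot_2 in \<open>auto\<close>)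
  next
    case 4
    \<comment> \<open>For j = 0 the subtraction yields i = 0, and the surplus factor
      \<open>haupt\<close> is absorbed into the polynomial.\<close>
    define i where "i = j - 1"
    have i: "3 * i \<le> m + 2" using less.prems 4 by (simp add: i_def)
    obtain h0 where h0: "h0 \<in> haupt_poly" "sect 3 0 (cubic_quot ^ m) = haupt ^ i * h0"
      using less.IH[of m i] i 4 by auto
    obtain h1 where h1: "h1 \<in> haupt_poly" "sect 3 0 (cubic_quot ^ (m + 1)) = haupt ^ i * h1"
      using less.IH[of "m + 1" i] i 4 by auto
    obtain h2 where h2: "h2 \<in> haupt_poly" "sect 3 0 (cubic_quot ^ (m + 2)) = haupt ^ i * h2"
      using less.IH[of "m + 2" i] i 4 by auto
    define h where "h = h0 + of_int 3 * h1 + of_int 3 * h2"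
    have h: "h \<in> haupt_poly"
      unfolding h_def using h0 h1 h2 by (intro haupt_poly_add haupt_poly_of_int_mult)
    have eq: "sect 3 0 (cubic_quot ^ k) = haupt * (haupt ^ i * h)"
      unfolding 4 sect_cubic_quot_power_add_3 h0 h1 h2 h_def by (simp add: algebra_simps)
    show ?thesis
    proof (cases j)
      case 0
      then show ?thesis using eq h haupt_poly_mult_haupt by (auto simp: i_def)
    next
      case (Suc j')
      then show ?thesis using eq h by (auto simp: i_def mult.assoc)
    qed
  qed
qed

lemma haupt_mult_haupt_compose: "haupt * (haupt oo fps_X ^ 3) = 9 * cubic_quot ^ 4"
proof -
  have E9: "E 3 oo fps_X ^ 3 = E 9" "E_inv 1 oo fps_X ^ 3 = E_inv 3"
    using E_compose[of 3 3] E_inv_compose[of 1 3] by simp_all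
  have "haupt * (haupt oo fps_X ^ 3)
      = 729 * (fps_X ^ 4 * E 9 ^ 12 * E_inv 1 ^ 12 * (E 3 ^ (0 + 12) * E_inv 3 ^ 12))"
    unfolding haupt_def compose_X_cubed E9
    by (simp add: mult_ac eval_nat_numeral)
  also have "\<dots> = 9 * cubic_quot ^ 4"
    by (subst E_power_E_inv_power) (simp_all add: cubic_quot_def power_mult_distrib mult_ac flip: power_mult)
  finally show ?thesis .
qed

text \<open>To extract from v^b T^i, multiply the result by T^i, which enters the extraction as
  T(q^3)^i. There (T T(q^3))^i = 9^i v^(4i), and v^(b + 4i) yields T^(i + 2) because b + 4i + 2
  \<ge> 3(i + 2) for b \<ge> 4. Finally T^i cancels.\<close>

lemma sect_cubic_quot_power_mult_haupt_poly:
  assumes "b \<ge> 4" "f \<in> haupt_poly"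
  shows "\<exists>h\<in>haupt_poly. sect 3 0 (cubic_quot ^ b * f) = haupt ^ 2 * h"
  using assms(2)
proof (induction f rule: haupt_poly.induct)
  case zero
  show ?case by (rule bexI[OF _ haupt_poly.zero]) (simp add: fps_eq_iff)
next
  case (monom f c i)
  then obtain h where h: "h \<in> haupt_poly" "sect 3 0 (cubic_quot ^ b * f) = haupt ^ 2 * h" by blast
  obtain g where g: "g \<in> haupt_poly" "sect 3 0 (cubic_quot ^ (b + 4 * i)) = haupt ^ (i + 2) * g"
    using sect_cubic_quot_power[of "i + 2" "b + 4 * i"] assms(1) by auto
  have "sect 3 0 (cubic_quot ^ b * haupt ^ i) * haupt ^ i
      = sect 3 0 (cubic_quot ^ b * haupt ^ i * (haupt ^ i oo fps_X ^ 3))"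
    by (simp only: sect_mult_compose zero_less_numeral)
  also have "cubic_quot ^ b * haupt ^ i * (haupt ^ i oo fps_X ^ 3)
      = cubic_quot ^ b * (haupt * (haupt oo fps_X ^ 3)) ^ i"
    unfolding compose_X_cubed by (simp only: power_mult_distrib mult_ac)
  also have "sect 3 0 (cubic_quot ^ b * (haupt * (haupt oo fps_X ^ 3)) ^ i)
      = 9 ^ i * sect 3 0 (cubic_quot ^ (b + 4 * i))"
    unfolding haupt_mult_haupt_compose sect_numeral_power_mult [symmetric] power_mult_distrib power_add power_mult
    by (simp only: mult_ac)
  also have "\<dots> = (haupt ^ 2 * (9 ^ i * g)) * haupt ^ i"
    unfolding g by (simp add: power_add power2_eq_square mult_ac)
  finally have 1: "sect 3 0 (cubic_quot ^ b * haupt ^ i) = haupt ^ 2 * (9 ^ i * g)"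
    using haupt_neq_0 by simp
  have "cubic_quot ^ b * (of_int c * haupt ^ i + f)
      = of_int c * (cubic_quot ^ b * haupt ^ i) + cubic_quot ^ b * f"
    by (simp add: algebra_simps)
  then have "sect 3 0 (cubic_quot ^ b * (of_int c * haupt ^ i + f))
      = of_int c * (haupt ^ 2 * (9 ^ i * g)) + haupt ^ 2 * h"
    by (simp only: sect_add sect_of_int_mult 1 h)
  also have "\<dots> = haupt ^ 2 * (of_int (c * 9 ^ i) * g + h)"
    by (simp add: algebra_simps)
  finally have "sect 3 0 (cubic_quot ^ b * (of_int c * haupt ^ i + f))
      = haupt ^ 2 * (of_int (c * 9 ^ i) * g + h)" .
  moreover have "of_int (c * 9 ^ i) * g + h \<in> haupt_poly"
    using g h by (intro haupt_poly_add haupt_poly_of_int_mult)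
  ultimately show ?case by blast
qed

text \<open>The factor q^b of v^b moves residue 6 - b to residue 0 and leaves q^2, which cancels
  against the q^2 of T^2. Of the 729 in T^2, the 3^b of v^b leaves 3^(6 - b).\<close>

lemma sect_E_inv_power_mult_haupt_poly:
  assumes "4 \<le> b" "b \<le> 6" "f \<in> haupt_poly"
  shows "\<exists>h\<in>haupt_poly. sect 3 (6 - b) (E_inv 1 ^ (3 * b) * f)
           = 3 ^ (6 - b) * (E 3 ^ 24 * E_inv 3 ^ (3 * b) * E_inv 1 ^ 24 * h)"
proof -
  obtain h where h: "h \<in> haupt_poly" "sect 3 0 (cubic_quot ^ b * f) = haupt ^ 2 * h"
    using sect_cubic_quot_power_mult_haupt_poly[OF assms(1,3)] by blast
  let ?S = "sect 3 (6 - b) (E_inv 1 ^ (3 * b) * f)"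
  have E9: "E 9 ^ (3 * b) = E 3 ^ (3 * b) oo fps_X ^ 3"
    using E_compose[of 3 3] by (simp add: fps_compose_X_power_ring_simps)
  have "b = 3 * 1 + 1 \<or> b = 3 * 1 + 2 \<or> b = 3 * 2 + 0" using assms by auto
  then have S: "sect 3 0 (fps_X ^ b * (E_inv 1 ^ (3 * b) * f)) = fps_X ^ 2 * ?S"
    using sect_X_power_mult_gt[where 'a = int and m = 3 and r = 0 and s = 1 and k = 1]
      sect_X_power_mult_gt[where 'a = int and m = 3 and r = 0 and s = 2 and k = 1]
      sect_X_power_mult_le[where 'a = int and m = 3 and r = 0 and s = 0 and k = 2]
    by (auto simp: numeral_2_eq_2 [symmetric])
  have "cubic_quot ^ b * f
      = 3 ^ b * ((fps_X ^ b * (E_inv 1 ^ (3 * b) * f)) * (E 3 ^ (3 * b) oo fps_X ^ 3))"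
    unfolding E9 [symmetric] cubic_quot_def
        by (simp add: power_mult_distrib mult_ac flip: power_mult)
  then have "haupt ^ 2 * h = 3 ^ b * (fps_X ^ 2 * ?S * E 3 ^ (3 * b))"
    unfolding h(2) [symmetric]
    by (simp only: sect_numeral_power_mult sect_mult_compose S zero_less_numeral)
  moreover have "(729 :: int fps) = 3 ^ b * 3 ^ (6 - b)"
    using assms by (simp flip: power_add)
  then have "haupt ^ 2 = 3 ^ b * (3 ^ (6 - b) * (fps_X ^ 2 * (E 3 ^ 24 * E_inv 1 ^ 24)))"
    unfolding haupt_def by (simp add: power_mult_distrib mult.assoc flip: power_mult)
  ultimately have "3 ^ b * (fps_X ^ 2 * (?S * E 3 ^ (3 * b)))
      = 3 ^ b * (fps_X ^ 2 * (3 ^ (6 - b) * (E 3 ^ 24 * E_inv 1 ^ 24 * h)))"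
    by (simp only: mult_ac)
  then have "?S * E 3 ^ (3 * b) = 3 ^ (6 - b) * (E 3 ^ 24 * E_inv 1 ^ 24 * h)"
    by simp
  then have "?S * (E 3 ^ (0 + 3 * b) * E_inv 3 ^ (3 * b))
      = 3 ^ (6 - b) * (E 3 ^ 24 * E_inv 3 ^ (3 * b) * E_inv 1 ^ 24 * h)"
    by (simp add: mult_ac)
  then have "?S = 3 ^ (6 - b) * (E 3 ^ 24 * E_inv 3 ^ (3 * b) * E_inv 1 ^ 24 * h)"
    by (subst (asm) E_power_E_inv_power) simp_all
  then show ?thesis using h(1) by blast
qed

text \<open>The start of the iteration has b = 1, too small for the general statement; here the
  exact value T of the extraction from v is used, and 9 is 27/3.\<close>

lemma sect_2_E_inv_cubed: "sect 3 2 (E_inv 1 ^ 3) = 9 * (E 3 ^ 9 * E_inv 1 ^ 12)"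
proof -
  have E9: "E 9 ^ 3 = E 3 ^ 3 oo fps_X ^ 3"
    using E_compose[of 3 3] by (simp add: fps_compose_X_power_ring_simps)
  have cubic_quot: "cubic_quot = 3 * (fps_X * E_inv 1 ^ 3 * (E 3 ^ 3 oo fps_X ^ 3))"
    by (simp add: cubic_quot_def E9 mult_ac)
  have "haupt = sect 3 0 cubic_quot" using sect_cubic_quot_1 by simp
  also have "\<dots> = 3 * (sect 3 0 (fps_X * E_inv 1 ^ 3) * E 3 ^ 3)"
    unfolding cubic_quot by (simp only: sect_numeral_mult sect_mult_compose zero_less_numeral)
  also have "sect 3 0 (fps_X * E_inv 1 ^ 3) = fps_X * sect 3 2 (E_inv 1 ^ 3)"
    using sect_X_power_mult_gt[where 'a = int and m = 3 and r = 0 and s = 1 and k = 0] by simp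
  finally have "3 * (fps_X * (sect 3 2 (E_inv 1 ^ 3) * E 3 ^ 3)) = haupt"
    by (simp only: mult_ac)
  also have "haupt = (3 * 9) * (fps_X * E 3 ^ (9 + 3) * E_inv 1 ^ 12)"
    by (simp add: haupt_def)
  also have "\<dots> = 3 * (fps_X * (9 * (E 3 ^ 9 * E_inv 1 ^ 12) * E 3 ^ 3))"
    unfolding power_add by (simp only: mult_ac)
  finally have "sect 3 2 (E_inv 1 ^ 3) * E 3 ^ 3 = 9 * (E 3 ^ 9 * E_inv 1 ^ 12) * E 3 ^ 3"
    unfolding mult_cancel_left by simp
  then show ?thesis using E_neq_0[of 3] by simp
qed

section \<open>The generating functions\<close>

text \<open>Recording E(q^3)^c / E(q)^(3b) as (c, 3b), the step maps (c, 3b) to (24 - 3b, 24 - c).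
  The cycles used are (9, 12), (12, 15) and (6, 12), (12, 18).\<close>

lemma sect_step:
  assumes "4 \<le> b" "b \<le> 6" "c \<le> 24" "f \<in> haupt_poly"
  shows "\<exists>h\<in>haupt_poly. sect 3 (6 - b) (E 3 ^ c * E_inv 1 ^ (3 * b) * f)
           = 3 ^ (6 - b) * (E 3 ^ (24 - 3 * b) * E_inv 1 ^ (24 - c) * h)"
proof -
  obtain h where h: "h \<in> haupt_poly" "sect 3 (6 - b) (E_inv 1 ^ (3 * b) * f)
           = 3 ^ (6 - b) * (E 3 ^ 24 * E_inv 3 ^ (3 * b) * E_inv 1 ^ 24 * h)"
    using sect_E_inv_power_mult_haupt_poly[OF assms(1,2,4)] by blast
  have "E 3 ^ c = E 1 ^ c oo fps_X ^ 3"
    using E_compose[of 1 3] by (simp add: compose_X_cubed)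
  then have "E 3 ^ c * E_inv 1 ^ (3 * b) * f = (E_inv 1 ^ (3 * b) * f) * (E 1 ^ c oo fps_X ^ 3)"
    by (simp only: mult_ac)
  moreover have "6 - b < 3" using assms by simp
  ultimately have "sect 3 (6 - b) (E 3 ^ c * E_inv 1 ^ (3 * b) * f)
      = 3 ^ (6 - b) * (E 3 ^ 24 * E_inv 3 ^ (3 * b) * E_inv 1 ^ 24 * h) * E 1 ^ c"
    by (simp only: sect_mult_compose h)
  also have "\<dots> = 3 ^ (6 - b) * ((E 3 ^ ((24 - 3 * b) + 3 * b) * E_inv 3 ^ (3 * b))
      * (E_inv 1 ^ ((24 - c) + c) * E 1 ^ c) * h)"
    using assms by (simp add: mult_ac)
  also have "\<dots> = 3 ^ (6 - b) * (E 3 ^ (24 - 3 * b) * E_inv 1 ^ (24 - c) * h)"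
    by (simp only: E_power_E_inv_power E_inv_power_E_power zero_less_numeral zero_less_one)
  finally show ?thesis using h(1) by blast
qed

text \<open>One round of the first cycle takes residue 2 and then residue 1, with gains 9 and 3.
  With K the old modulus the offset grows by 2K + 3K, which turns 5K + 1 into 5 (9K) + 1 in the
  numerator.\<close>

lemma sect_E_inv_cubed_iterated:
  "\<exists>h\<in>haupt_poly. sect (3 ^ (2 * a + 1)) ((5 * 3 ^ (2 * a + 1) + 1) div 8) (E_inv 1 ^ 3)
     = 3 ^ (3 * a + 2) * (E 3 ^ 9 * E_inv 1 ^ 12 * h)"
proof (induction a)
  case 0
  show ?case
    using sect_2_E_inv_cubed haupt_poly_haupt_power[of 0] by (intro bexI[of _ 1]) simp_all
next
  case (Suc a)
  define K :: nat where "K = 3 ^ (2 * a + 1)"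
  define s where "s = (5 * K + 1) div 8"
  define N where "N = 3 * a + 2"
  obtain h where h: "h \<in> haupt_poly" "sect K s (E_inv 1 ^ 3) = 3 ^ N * (E 3 ^ 9 * E_inv 1 ^ 12 * h)"
    using Suc by (auto simp: K_def s_def N_def)
  obtain h1 where h1: "h1 \<in> haupt_poly"
    "sect 3 2 (E 3 ^ 9 * E_inv 1 ^ 12 * h) = 3 ^ 2 * (E 3 ^ 12 * E_inv 1 ^ 15 * h1)"
    using sect_step[of 4 9 h] h by auto
  obtain h2 where h2: "h2 \<in> haupt_poly"
    "sect 3 1 (E 3 ^ 12 * E_inv 1 ^ 15 * h1) = 3 * (E 3 ^ 9 * E_inv 1 ^ 12 * h2)"
    using sect_step[of 5 12 h1] h1 by auto
  have "sect 3 1 (sect 3 2 (sect K s (E_inv 1 ^ 3)))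
      = 3 ^ N * (3 ^ 2 * (3 * (E 3 ^ 9 * E_inv 1 ^ 12 * h2)))"
    by (simp only: h h1 h2 sect_numeral_power_mult)
  also have "\<dots> = 3 ^ (3 * Suc a + 2) * (E 3 ^ 9 * E_inv 1 ^ 12 * h2)"
    by (simp add: N_def power_add)
  finally have "sect (K * 3 * 3) (K * 3 * 1 + (K * 2 + s)) (E_inv 1 ^ 3)
      = 3 ^ (3 * Suc a + 2) * (E 3 ^ 9 * E_inv 1 ^ 12 * h2)"
    unfolding sect_sect .
  moreover have "K * 3 * 3 = 3 ^ (2 * Suc a + 1)"
    by (simp add: K_def)
  moreover have "K * 3 * 1 + (K * 2 + s) = (5 * (K * 3 * 3) + 1) div 8"
    unfolding s_def by presburger
  ultimately show ?case using h2(1) by metis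
qed

definition p3_gf :: "nat \<Rightarrow> int fps" where
  "p3_gf l = E_inv 1 ^ 3 * E_inv l ^ 3"

lemma p3_eq_p3_gf_nth:
  assumes "l > 0"
  shows "p3 l n = fps_nth (p3_gf l) n"
proof -
  define P where "P = Abs_fps (p3 l)"
  have "p3_gf l * (E 1 ^ 3 * E l ^ 3) = (E 1 * E_inv 1) ^ 3 * (E l * E_inv l) ^ 3"
    by (simp only: p3_gf_def power_mult_distrib mult_ac)
  then have "p3_gf l * (E 1 ^ 3 * E l ^ 3) = P * (E 1 ^ 3 * E l ^ 3)"
    using assms p3_generating_function[of l] by (simp add: E_E_inv P_def)
  then have "p3_gf l = P"
    using E_neq_0[of 1] E_neq_0[of l] assms by simp
  then show ?thesis by (simp add: P_def)
qed

lemma sect_p3_gf_odd: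
  "\<exists>h\<in>haupt_poly. sect (3 ^ (2 * \<alpha> + 2 * \<beta> + 1)) ((2 * 3 ^ (2 * \<alpha> + 2 * \<beta> + 1) + 3 ^ (2 * \<alpha> + 2)
      + 1) div 8)
       (p3_gf (3 ^ (2 * \<alpha> + 2)))
     = 3 ^ (3 * \<alpha> + 2 * \<beta> + 2) * (E 3 ^ 6 * E_inv 1 ^ 12 * h)"
  and sect_p3_gf_even:
  "\<exists>h\<in>haupt_poly. sect (3 ^ (2 * \<alpha> + 2 * \<beta> + 2)) ((18 * 3 ^ (2 * \<alpha> + 2 * \<beta> + 1) + 3 ^ (2 * \<alpha> + 2)
      + 1) div 8)
       (p3_gf (3 ^ (2 * \<alpha> + 2)))
     = 3 ^ (3 * \<alpha> + 2 * \<beta> + 4) * (E 3 ^ 12 * E_inv 1 ^ 18 * h)"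
proof -
  define C :: nat where "C = 3 ^ (2 * \<alpha> + 2)"
  define G where "G = p3_gf C"
  have even: "\<exists>h\<in>haupt_poly. sect (K * 3) ((18 * K + C + 1) div 8) G
      = 3 ^ (N + 2) * (E 3 ^ 12 * E_inv 1 ^ 18 * h)"
    if h: "h \<in> haupt_poly" "sect K ((2 * K + C + 1) div 8) G
        = 3 ^ N * (E 3 ^ 6 * E_inv 1 ^ 12 * h)" for K N h
  proof -
    obtain h1 where h1: "h1 \<in> haupt_poly"
      "sect 3 2 (E 3 ^ 6 * E_inv 1 ^ 12 * h) = 3 ^ 2 * (E 3 ^ 12 * E_inv 1 ^ 18 * h1)"
      using sect_step[of 4 6 h] h by auto
    have "sect 3 2 (sect K ((2 * K + C + 1) div 8) G)
        = 3 ^ N * (3 ^ 2 * (E 3 ^ 12 * E_inv 1 ^ 18 * h1))"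
      by (simp only: h h1 sect_numeral_power_mult)
    then have "sect (K * 3) (K * 2 + (2 * K + C + 1) div 8) G
        = 3 ^ (N + 2) * (E 3 ^ 12 * E_inv 1 ^ 18 * h1)"
      unfolding sect_sect power_add by (simp only: mult_ac)
    moreover have "K * 2 + (2 * K + C + 1) div 8 = (18 * K + C + 1) div 8"
      by presburger
    ultimately show ?thesis using h1(1) by metis
  qed
  have odd: "\<exists>h\<in>haupt_poly. sect (3 ^ (2 * \<alpha> + 2 * \<beta> + 1)) ((2 * 3 ^ (2 * \<alpha> + 2 * \<beta> + 1) + C
      + 1) div 8) G
     = 3 ^ (3 * \<alpha> + 2 * \<beta> + 2) * (E 3 ^ 6 * E_inv 1 ^ 12 * h)" for \<beta>
  proof (induction \<beta>)
    case 0
    define K :: nat where "K = 3 ^ (2 * \<alpha> + 1)"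
    have K: "K > 0" "C = 3 * K" by (simp_all add: K_def C_def)
    obtain h where h: "h \<in> haupt_poly"
      "sect K ((5 * K + 1) div 8) (E_inv 1 ^ 3) = 3 ^ (3 * \<alpha> + 2) * (E 3 ^ 9 * E_inv 1 ^ 12 * h)"
      using sect_E_inv_cubed_iterated[of \<alpha>] by (auto simp: K_def)
    \<comment> \<open>As C = 3K, the factor 1/E(q^C)^3 is a series in q^K and comes out as
      1/E(q^3)^3, lowering the exponent 9 of E(q^3) to 6. This starts the second cycle; also 5K + 1
      = 2K + C + 1.\<close>
    have "E_inv C ^ 3 = E_inv 3 ^ 3 oo fps_X ^ K"
      using K E_inv_compose[of 3 K] by (simp add: fps_compose_X_power_ring_simps)
    moreover have "(5 * K + 1) div 8 < K" using K by presburger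
    ultimately have "sect K ((5 * K + 1) div 8) G
        = 3 ^ (3 * \<alpha> + 2) * (E 3 ^ 9 * E_inv 1 ^ 12 * h) * E_inv 3 ^ 3"
      unfolding G_def p3_gf_def by (simp only: sect_mult_compose h)
    also have "\<dots> = 3 ^ (3 * \<alpha> + 2) * ((E 3 ^ (6 + 3) * E_inv 3 ^ 3) * E_inv 1 ^ 12 * h)"
      by (simp add: mult_ac)
    also have "\<dots> = 3 ^ (3 * \<alpha> + 2) * (E 3 ^ 6 * E_inv 1 ^ 12 * h)"
      by (simp only: E_power_E_inv_power zero_less_numeral)
    finally show ?case using h(1) K by (auto simp: K_def)
  next
    case (Suc \<beta>)
    define K :: nat where "K = 3 ^ (2 * \<alpha> + 2 * \<beta> + 1)"
    define N where "N = 3 * \<alpha> + 2 * \<beta> + 2"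
    obtain h where h: "h \<in> haupt_poly" "sect K ((2 * K + C + 1) div 8) G
        = 3 ^ N * (E 3 ^ 6 * E_inv 1 ^ 12 * h)"
      using Suc by (auto simp: K_def N_def)
    obtain h1 where h1: "h1 \<in> haupt_poly"
      "sect (K * 3) ((18 * K + C + 1) div 8) G = 3 ^ (N + 2) * (E 3 ^ 12 * E_inv 1 ^ 18 * h1)"
      using even[OF h] by blast
    obtain h2 where h2: "h2 \<in> haupt_poly"
      "sect 3 0 (E 3 ^ 12 * E_inv 1 ^ 18 * h1) = E 3 ^ 6 * E_inv 1 ^ 12 * h2"
      using sect_step[of 6 12 h1] h1 by auto
    have "sect 3 0 (sect (K * 3) ((18 * K + C + 1) div 8) G)
        = 3 ^ (N + 2) * (E 3 ^ 6 * E_inv 1 ^ 12 * h2)"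
      by (simp only: h1 h2 sect_numeral_power_mult)
    \<comment> \<open>Residue 0 keeps the offset, and 18 K = 2 (9 K) has the required form for the
      new modulus.\<close>
    then have "sect (9 * K) ((2 * (9 * K) + C + 1) div 8) G
        = 3 ^ (N + 2) * (E 3 ^ 6 * E_inv 1 ^ 12 * h2)"
      unfolding sect_sect by (simp add: mult_ac)
    moreover have "9 * K = 3 ^ (2 * \<alpha> + 2 * Suc \<beta> + 1)" "N + 2 = 3 * \<alpha> + 2 * Suc \<beta> + 2"
      by (simp_all add: K_def N_def)
    ultimately show ?case using h2(1) by metis
  qed
  show "\<exists>h\<in>haupt_poly. sect (3 ^ (2 * \<alpha> + 2 * \<beta> + 1)) ((2 * 3 ^ (2 * \<alpha> + 2 * \<beta> + 1) + 3 ^ (2 * \<alpha>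
      + 2) + 1) div 8)
       (p3_gf (3 ^ (2 * \<alpha> + 2)))
     = 3 ^ (3 * \<alpha> + 2 * \<beta> + 2) * (E 3 ^ 6 * E_inv 1 ^ 12 * h)"
    using odd[of \<beta>] unfolding G_def C_def .
  obtain h where h: "h \<in> haupt_poly"
    "sect (3 ^ (2 * \<alpha> + 2 * \<beta> + 1)) ((2 * 3 ^ (2 * \<alpha> + 2 * \<beta> + 1) + C + 1) div 8) G
       = 3 ^ (3 * \<alpha> + 2 * \<beta> + 2) * (E 3 ^ 6 * E_inv 1 ^ 12 * h)"
    using odd[of \<beta>] by blast
  have "3 ^ (2 * \<alpha> + 2 * \<beta> + 2) = (3 ^ (2 * \<alpha> + 2 * \<beta> + 1) * 3 :: nat)"
    "3 * \<alpha> + 2 * \<beta> + 4 = (3 * \<alpha> + 2 * \<beta> + 2) + 2"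
    by simp_all
  then show "\<exists>h\<in>haupt_poly. sect (3 ^ (2 * \<alpha> + 2 * \<beta> + 2)) ((18 * 3 ^ (2 * \<alpha> + 2 * \<beta> + 1)
      + 3 ^ (2 * \<alpha> + 2) + 1) div 8)
       (p3_gf (3 ^ (2 * \<alpha> + 2)))
     = 3 ^ (3 * \<alpha> + 2 * \<beta> + 4) * (E 3 ^ 12 * E_inv 1 ^ 18 * h)"
    using even[OF h] unfolding G_def C_def by (simp only:)
qed

section \<open>Divisibility in one further extraction\<close>

lemma numeral_dvd_sect: "(numeral k :: int fps) dvd F \<Longrightarrow> numeral k dvd sect m r F"
  by (auto simp: numeral_dvd_fps_iff)

lemma sect_E_3_power_mult: "r < 3 \<Longrightarrow> sect 3 r (E 3 ^ c * F) = E 1 ^ c * sect 3 r F"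
  using E_compose[of 1 3] sect_mult_compose[of r 3 F "E 1 ^ c"]
  by (simp add: compose_X_cubed mult.commute)

lemma numeral_dvd_sect_mult_haupt_poly:
  assumes "\<And>c. numeral k dvd sect m r (F * of_int c)" "(numeral k :: int fps) dvd 27"
      "h \<in> haupt_poly"
  shows "numeral k dvd sect m r (F * h)"
proof -
  obtain c where c: "27 dvd h - of_int c"
    using haupt_poly_const_mod_27[OF assms(3)] .
  have "numeral k dvd F * (h - of_int c)"
    using assms(2) c by (meson dvd_mult dvd_trans)
  then have "numeral k dvd sect m r (F * of_int c) + sect m r (F * (h - of_int c))"
    by (intro dvd_add[OF assms(1)] numeral_dvd_sect)
  then show ?thesis
    unfolding sect_add [symmetric] by (simp add: algebra_simps)
qed

text \<open>Since \<open>E(q)\<^sup>3 = A(q\<^sup>3) - 3qE(q\<^sup>9)\<^sup>3\<close>, the series \<open>E(q)\<^sup>-\<^sup>3\<close> is the sum of a geometric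
  series in \<open>3z\<close> where all exponents of \<open>z\<close> are 1 modulo 3.\<close>

lemma E_inv_cubed_expansion:
  obtains B G where "E_inv 1 ^ 3 = (B oo fps_X ^ 3) + 3 * (fps_X * (G oo fps_X ^ 3)) * E_inv 1 ^ 3"
proof -
  have "fps_nth E_cubed_sect 0 = 1"
    by (simp add: E_cubed_sect_def E_has_prod(2) fps_nth_power_0 flip: One_nat_def)
  then obtain B where B: "E_cubed_sect * B = 1" by (rule fps_unit_exists)
  have AB: "(E_cubed_sect oo fps_X ^ 3) * (B oo fps_X ^ 3) = 1"
    unfolding compose_X_cubed(3) [symmetric] B compose_X_cubed ..
  have E9: "E 9 ^ 3 = E 3 ^ 3 oo fps_X ^ 3"
    using E_compose[of 3 3] by (simp add: compose_X_cubed)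
  have "1 = E 1 ^ 3 * E_inv 1 ^ 3"
    using E_E_inv[of 1] by (simp flip: power_mult_distrib)
  also have "\<dots> = (E_cubed_sect oo fps_X ^ 3) * E_inv 1 ^ 3 - 3 * (fps_X * E 9 ^ 3) * E_inv 1 ^ 3"
    unfolding E_1_cubed_dissect by (simp add: algebra_simps)
  finally have 1: "(E_cubed_sect oo fps_X ^ 3) * E_inv 1 ^ 3
      = 1 + 3 * (fps_X * E 9 ^ 3) * E_inv 1 ^ 3"
    by (simp add: algebra_simps)
  have "E_inv 1 ^ 3 = (E_cubed_sect oo fps_X ^ 3) * (B oo fps_X ^ 3) * E_inv 1 ^ 3"
    by (simp add: AB)
  also have "\<dots> = (B oo fps_X ^ 3) * ((E_cubed_sect oo fps_X ^ 3) * E_inv 1 ^ 3)"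
    by (simp only: mult_ac)
  also have "\<dots> = (B oo fps_X ^ 3) + 3 * (fps_X * ((B * E 3 ^ 3) oo fps_X ^ 3)) * E_inv 1 ^ 3"
    unfolding 1 compose_X_cubed(3) E9 by (simp add: algebra_simps)
  finally show ?thesis by (rule that)
qed

lemma dvd_power_diff_power:
  fixes x y :: "'a::comm_ring_1"
  assumes "d dvd x - y"
  shows "d dvd x ^ n - y ^ n"
  unfolding power_diff_sumr2 using assms by simp

text \<open>Modulo 3 the expansion makes 1/E(q)^3, and hence its fourth power, a series in
  q^3.\<close>

lemma sect_1_E_inv_12: "3 dvd sect 3 1 (E_inv 1 ^ 12)"
proof -
  obtain B G where BG: "E_inv 1 ^ 3
      = (B oo fps_X ^ 3) + 3 * (fps_X * (G oo fps_X ^ 3)) * E_inv 1 ^ 3"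
    using E_inv_cubed_expansion .
  have "E_inv 1 ^ 3 - (B oo fps_X ^ 3) = 3 * (fps_X * (G oo fps_X ^ 3) * E_inv 1 ^ 3)"
    by (subst BG) simp
  then have "3 dvd (E_inv 1 ^ 3) ^ 4 - (B oo fps_X ^ 3) ^ 4"
    by (intro dvd_power_diff_power) simp
  then have "3 dvd sect 3 1 (E_inv 1 ^ 12) - sect 3 1 (fps_X ^ 0 * (B ^ 4 oo fps_X ^ 3))"
    unfolding sect_diff [symmetric] compose_X_cubed
    by (intro numeral_dvd_sect) (simp flip: power_mult)
  then show ?thesis
    by (subst (asm) sect_X_power_mult_compose) simp_all
qed

text \<open>Modulo 27 the geometric series stops at z^2 and its sixth power is b^6 (1 + 18 z),
  because all later coefficients are multiples of 27. The exponents of b are 0 and those of z are 1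
  modulo 3, so residue 1 retains a factor 18 and residue 2 vanishes.\<close>

lemma sect_E_inv_18:
  shows "9 dvd sect 3 1 (E_inv 1 ^ 18)" and "27 dvd sect 3 2 (E_inv 1 ^ 18)"
proof -
  obtain B G where BG: "E_inv 1 ^ 3
      = (B oo fps_X ^ 3) + 3 * (fps_X * (G oo fps_X ^ 3)) * E_inv 1 ^ 3"
    using E_inv_cubed_expansion .
  define b z I where "b = B oo fps_X ^ 3" and "z = fps_X * (G oo fps_X ^ 3)" and "I = E_inv 1 ^ 3"
  have I: "I = b + 3 * z * I" using BG by (simp only: b_def z_def I_def)
  \<comment> \<open>Three substitutions of the equation into itself push the unknown remainder to 27
    z^3 I.\<close>
  have "I = b + 3 * z * (b + 3 * z * (b + 3 * z * I))"
    using I by metis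
  also have "\<dots> = b * (1 + 3 * z + 9 * z ^ 2) + 27 * (z ^ 3 * I)"
    by (simp add: algebra_simps power2_eq_square power3_eq_cube)
  finally have "I - b * (1 + 3 * z + 9 * z ^ 2) = 27 * (z ^ 3 * I)"
    by (metis add_diff_cancel_left')
  then have "27 dvd I - b * (1 + 3 * z + 9 * z ^ 2)" by (rule dvdI)
  then have 1: "27 dvd I ^ 6 - (b * (1 + 3 * z + 9 * z ^ 2)) ^ 6"
    by (rule dvd_power_diff_power)
  have w: "(1 + 3 * w) ^ 6 = 1 + 18 * w + 135 * w ^ 2
      + 27 * (20 * w ^ 3 + 45 * w ^ 4 + 54 * w ^ 5 + 27 * w ^ 6)" for w :: "int fps"
    by (simp add: algebra_simps eval_nat_numeral)
  define w where "w = z + 3 * z ^ 2"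
  have "1 + 3 * z + 9 * z ^ 2 = 1 + 3 * w"
    by (simp add: w_def)
  moreover have "1 + 18 * w + 135 * w ^ 2 = 1 + 18 * z + 27 * (7 * z ^ 2 + 30 * z ^ 3 + 45 * z ^ 4)"
    by (simp add: w_def algebra_simps eval_nat_numeral)
  ultimately have "(1 + 3 * z + 9 * z ^ 2) ^ 6
      = 1 + 18 * z + 27 * (7 * z ^ 2 + 30 * z ^ 3 + 45 * z ^ 4
      + (20 * w ^ 3 + 45 * w ^ 4 + 54 * w ^ 5 + 27 * w ^ 6))"
    by (simp only: w distrib_left add.assoc)
  then have "(b * (1 + 3 * z + 9 * z ^ 2)) ^ 6 - b ^ 6 * (1 + 18 * z)
      = 27 * (b ^ 6 * (7 * z ^ 2 + 30 * z ^ 3 + 45 * z ^ 4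
      + (20 * w ^ 3 + 45 * w ^ 4 + 54 * w ^ 5 + 27 * w ^ 6)))"
    unfolding power_mult_distrib
        by (simp only:) (simp only: distrib_left mult_ac add_diff_cancel_left')
  then have 2: "27 dvd (b * (1 + 3 * z + 9 * z ^ 2)) ^ 6 - b ^ 6 * (1 + 18 * z)" by simp
  have "27 dvd I ^ 6 - b ^ 6 * (1 + 18 * z)"
    using dvd_add[OF 1 2] by simp
  moreover have "b ^ 6 * (1 + 18 * z) = fps_X ^ 0 * (B ^ 6 oo fps_X ^ 3)
      + 18 * (fps_X ^ 1 * ((B ^ 6 * G) oo fps_X ^ 3))"
    unfolding b_def z_def compose_X_cubed by (simp add: algebra_simps)
  moreover have "I ^ 6 = E_inv 1 ^ 18" by (simp add: I_def flip: power_mult)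
  ultimately have *: "27 dvd sect 3 r (E_inv 1 ^ 18)
      - (sect 3 r (fps_X ^ 0 * (B ^ 6 oo fps_X ^ 3))
          + 18 * sect 3 r (fps_X ^ 1 * ((B ^ 6 * G) oo fps_X ^ 3)))"
    for r
    unfolding sect_numeral_mult [symmetric] sect_diff [symmetric] sect_add [symmetric]
    by (intro numeral_dvd_sect) simp
  show "27 dvd sect 3 2 (E_inv 1 ^ 18)"
    using *[of 2] by (subst (asm) (1 2) sect_X_power_mult_compose) simp_all
  have "27 dvd sect 3 1 (E_inv 1 ^ 18) - 18 * (B ^ 6 * G)"
    using *[of 1] by (subst (asm) (1 2) sect_X_power_mult_compose) simp_all
  moreover have "(9 :: int fps) dvd 27" "(9 :: int fps) dvd 18 * (B ^ 6 * G)"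
    by (rule dvdI[of _ _ 3], simp) (rule dvdI[of _ _ "2 * (B ^ 6 * G)"], simp)
  ultimately have "9 dvd (sect 3 1 (E_inv 1 ^ 18) - 18 * (B ^ 6 * G)) + 18 * (B ^ 6 * G)"
    by (intro dvd_add) (auto intro: dvd_trans)
  then show "9 dvd sect 3 1 (E_inv 1 ^ 18)" by simp
qed

section \<open>The sixth power of E and sums of two squares\<close>

text \<open>Cubing the congruence of E(q)^3 and E(q^3) lifts the modulus from 3 to 9. Squaring and
  multiplying by 1/E(q)^12 then gives the claim.\<close>

lemma E_1_power_6_cong: "9 dvd E 1 ^ 6 - E 3 ^ 6 * E_inv 1 ^ 12"
proof -
  obtain u where "E 1 ^ 3 - E 3 = 3 * u" using E_1_cubed_cong by (elim dvdE)
  then have "E 1 ^ 3 = E 3 + 3 * u" by (simp add: algebra_simps)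
  then have "(E 1 ^ 3) ^ 3 - E 3 ^ 3 = 9 * (E 3 ^ 2 * u + 3 * E 3 * u ^ 2 + 3 * u ^ 3)"
    by (simp add: algebra_simps power2_eq_square power3_eq_cube)
  then have "9 dvd (E 1 ^ 3) ^ 3 - E 3 ^ 3" by (rule dvdI)
  then have "9 dvd ((E 1 ^ 3) ^ 3) ^ 2 - (E 3 ^ 3) ^ 2" by (rule dvd_power_diff_power)
  then have "9 dvd (E 1 ^ 18 - E 3 ^ 6) * E_inv 1 ^ 12"
    by (simp flip: power_mult)
  also have "(E 1 ^ 18 - E 3 ^ 6) * E_inv 1 ^ 12
      = E 1 ^ (6 + 12) * E_inv 1 ^ 12 - E 3 ^ 6 * E_inv 1 ^ 12"
    by (simp add: algebra_simps)
  also have "E 1 ^ (6 + 12) * E_inv 1 ^ 12 = E 1 ^ 6"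
    by (subst E_power_E_inv_power) simp_all
  finally show ?thesis .
qed

text \<open>By Jacobi's identity a nonzero product of coefficients needs n =
  \<open>triang j + triang k\<close>, and then 4n + 1 = (j + k + 1)^2 + (j - k)^2.\<close>

lemma E_1_power_6_nth:
  assumes "\<And>x y :: int. 4 * int n + 1 \<noteq> x ^ 2 + y ^ 2"
  shows "fps_nth (E 1 ^ 6) n = 0"
proof -
  have "fps_nth (E 1 ^ 3) i * fps_nth (E 1 ^ 3) (n - i) = 0" if "i \<le> n" for i
  proof (rule ccontr)
    assume "\<not> ?thesis"
    then obtain j k where jk: "i = triang j" "n - i = triang k"
      using E_1_cubed_nth_not_triang[of i] E_1_cubed_nth_not_triang[of "n - i"] by auto
    then have "2 * n = j * (j + 1) + k * (k + 1)"
      using two_triang[of j] two_triang[of k] that by linarith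
    then have "2 * int n = int j * (int j + 1) + int k * (int k + 1)"
      by (metis (mono_tags) of_nat_add of_nat_mult of_nat_1 of_nat_numeral)
    then have "4 * int n + 1 = (int j + int k + 1) ^ 2 + (int j - int k) ^ 2"
      by (simp add: algebra_simps power2_eq_square)
    then show False using assms by blast
  qed
  then have "fps_nth (E 1 ^ 3 * E 1 ^ 3) n = 0"
    unfolding fps_mult_nth by (intro sum.neutral) simp
  then show ?thesis by (simp flip: power_add)
qed

text \<open>If p does not divide x, it does not divide y either. Raising x^2 = -y^2 modulo p to the
  odd power (p - 1)/2 and applying Fermat's theorem makes p divide 2.\<close>

lemma prime_3_mod_4_dvd_sum_squares:
  fixes x y :: int
  assumes "prime p" "p mod 4 = 3" "int p dvd x ^ 2 + y ^ 2"
  shows "int p dvd x"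
proof (rule ccontr)
  assume x: "\<not> int p dvd x"
  have p: "prime (int p)" using assms by simp
  have y: "\<not> int p dvd y"
  proof
    assume "int p dvd y"
    then have "int p dvd y ^ 2" by (simp add: power2_eq_square)
    then have "int p dvd x ^ 2" using assms(3) by (simp add: dvd_add_left_iff)
    then show False using x p prime_dvd_power by blast
  qed
  define e where "e = (p - 1) div 2"
  have e: "odd e" "2 * e = p - 1"
    using assms(2) unfolding e_def by presburger+
  have fermat: "[z ^ (p - 1) = 1] (mod int p)" if "\<not> int p dvd z" for z :: int
  proof -
    define a where "a = nat (z mod int p)"
    have a: "int a = z mod int p" using assms(1) by (simp add: a_def prime_gt_0_nat)
    have "\<not> p dvd a"
      using that a by (metis dvd_mod_iff dvd_refl int_dvd_int_iff)
    then have "[a ^ (p - 1) = 1] (mod p)" by (rule fermat_theorem[OF assms(1)])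
    then have "[int a ^ (p - 1) = 1] (mod int p)"
      by (metis cong_int_iff of_nat_1 of_nat_power)
    then show ?thesis unfolding a by (simp add: cong_def power_mod)
  qed
  have "int p dvd (x ^ 2) ^ e - (- (y ^ 2)) ^ e"
    using assms(3) by (intro dvd_power_diff_power) simp
  then have "int p dvd x ^ (p - 1) + y ^ (p - 1)"
    using e by (simp flip: power_mult)
  moreover have "[x ^ (p - 1) + y ^ (p - 1) = 1 + 1] (mod int p)"
    using x y by (intro cong_add fermat)
  ultimately have "int p dvd 2"
    using cong_dvd_iff by fastforce
  then have "p \<le> 2" using zdvd_imp_le[of "int p" 2] by simp
  then show False using assms(2) by presburger
qed

text \<open>Descent: p divides x and y, so p^2 cancels and k drops by one. At k = 0, p^2 divides p *
  u.\<close>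

lemma sum_squares_odd_prime_power:
  fixes x y :: int
  assumes "prime p" "p mod 4 = 3" "int (p ^ (2 * k + 1) * u) = x ^ 2 + y ^ 2"
  shows "p dvd u"
  using assms(3)
proof (induction k arbitrary: x y)
  case (0 x y)
  have "int p dvd x ^ 2 + y ^ 2" unfolding 0 [symmetric] by simp
  then have "int p dvd x" "int p dvd y"
    using prime_3_mod_4_dvd_sum_squares[OF assms(1,2)] by (metis add.commute)+
  then have "int p ^ 2 dvd int p * int u"
    using 0 by (metis dvd_add dvd_power_same of_nat_mult power_one_right mult_0_right add_0)
  then show ?case
    using assms(1) by (simp add: power2_eq_square prime_gt_0_nat)
next
  case (Suc k x y)
  have "int p dvd x ^ 2 + y ^ 2" unfolding Suc.prems [symmetric] by simp
  then have "int p dvd x" "int p dvd y"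
    using prime_3_mod_4_dvd_sum_squares[OF assms(1,2)] by (metis add.commute)+
  then obtain x' y' where xy: "x = int p * x'" "y = int p * y'" by (auto elim!: dvdE)
  have "int p ^ 2 * int (p ^ (2 * k + 1) * u) = int p ^ 2 * (x' ^ 2 + y' ^ 2)"
    using Suc.prems unfolding xy by (simp add: algebra_simps power2_eq_square)
  then have "int (p ^ (2 * k + 1) * u) = x' ^ 2 + y' ^ 2"
    using assms(1) by (simp add: prime_gt_0_nat)
  then show ?case by (rule Suc.IH)
qed

lemma fps_nth_numeral_power_mult:
  "fps_nth (numeral k ^ m * F :: int fps) n = numeral k ^ m * fps_nth F n"
  by (induction m) (simp_all add: mult.assoc numeral_fps_const)

theorem theorem1p6:
  fixes \<alpha> \<beta> k :: nat
  shows
    "(\<forall>n::nat. [p3 (3^(2*\<alpha>+2)) (3^(2*\<alpha>+2*\<beta>+1) * n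
         + (2 * 3^(2*\<alpha>+2*\<beta>+1) + 3^(2*\<alpha>+2) + 1) div 8) = 0] (mod 3^(3*\<alpha>+2*\<beta>+2)))
   \<and> (\<forall>n::nat. [p3 (3^(2*\<alpha>+2)) (3^(2*\<alpha>+2*\<beta>+2) * n
         + (10 * 3^(2*\<alpha>+2*\<beta>+1) + 3^(2*\<alpha>+2) + 1) div 8) = 0] (mod 3^(3*\<alpha>+2*\<beta>+3)))
   \<and> (\<forall>n::nat. [p3 (3^(2*\<alpha>+2)) (3^(2*\<alpha>+2*\<beta>+3) * n
         + (14 * 3^(2*\<alpha>+2*\<beta>+2) + 3^(2*\<alpha>+2) + 1) div 8) = 0] (mod 3^(3*\<alpha>+2*\<beta>+6)))
   \<and> (\<forall>n::nat. [p3 (3^(2*\<alpha>+2)) (3^(2*\<alpha>+2*\<beta>+3) * n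
         + (22 * 3^(2*\<alpha>+2*\<beta>+2) + 3^(2*\<alpha>+2) + 1) div 8) = 0] (mod 3^(3*\<alpha>+2*\<beta>+7)))
   \<and> (\<forall>(p::nat) (n::nat). prime p \<and> [p = 3] (mod 4) \<and> \<not> p dvd n \<longrightarrow>
       [p3 (3^(2*\<alpha>+2)) (3^(2*\<alpha>+2*\<beta>+1) * p^(2*k+1) * n
         + (2 * p^(2*k+2) * 3^(2*\<alpha>+2*\<beta>+1) + 3^(2*\<alpha>+2) + 1) div 8) = 0]
         (mod 3^(3*\<alpha>+2*\<beta>+4)))"
proof -
  define K :: nat where "K = 3 ^ (2 * \<alpha> + 2 * \<beta> + 1)"
  define C :: nat where "C = 3 ^ (2 * \<alpha> + 2)"
  define N where "N = 3 * \<alpha> + 2 * \<beta> + 2"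
  have K: "3 ^ (2 * \<alpha> + 2 * \<beta> + 2) = 3 * K" "3 ^ (2 * \<alpha> + 2 * \<beta> + 3) = 9 * K"
    by (simp_all add: K_def power_add)
  have N: "3 * \<alpha> + 2 * \<beta> + 3 = N + 1" "3 * \<alpha> + 2 * \<beta> + 4 = N + 2"
    "3 * \<alpha> + 2 * \<beta> + 6 = N + 2 + 2" "3 * \<alpha> + 2 * \<beta> + 7 = N + 2 + 3"
    by (simp_all add: N_def)
  have p3: "p3 C m = fps_nth (p3_gf C) m" for m
    by (rule p3_eq_p3_gf_nth) (simp add: C_def)
  obtain f where f: "f \<in> haupt_poly" "sect K ((2 * K + C + 1) div 8) (p3_gf C)
      = 3 ^ N * (E 3 ^ 6 * E_inv 1 ^ 12 * f)"
    using sect_p3_gf_odd[of \<alpha> \<beta>] unfolding K_def C_def N_def by blast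
  obtain g where g: "g \<in> haupt_poly"
    "sect (3 * K) ((18 * K + C + 1) div 8) (p3_gf C) = 3 ^ (N + 2) * (E 3 ^ 12 * E_inv 1 ^ 18 * g)"
    using sect_p3_gf_even[of \<alpha> \<beta>] unfolding K N K_def [symmetric] C_def [symmetric] by blast
  have odd: "p3 C (K * m + (2 * K + C + 1) div 8)
      = 3 ^ N * fps_nth (E 3 ^ 6 * E_inv 1 ^ 12 * f) m" for m
    unfolding p3 sect_nth [symmetric] f(2) by (rule fps_nth_numeral_power_mult)
  have even: "p3 C (3 * K * m + (18 * K + C + 1) div 8)
      = 3 ^ (N + 2) * fps_nth (E 3 ^ 12 * E_inv 1 ^ 18 * g) m" for m
    unfolding p3 sect_nth [symmetric] g(2) by (rule fps_nth_numeral_power_mult)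
  \<comment> \<open>E(q^3)^j leaves the extraction as a factor E(q)^j, and h may be replaced by its
    constant modulo 27, so only the power of 1/E(q) matters.\<close>
  have const: "numeral i dvd sect 3 r (E 3 ^ j * E_inv 1 ^ l * h)"
    if "r < 3" "(numeral i :: int fps) dvd sect 3 r (E_inv 1 ^ l)" "(numeral i :: int fps) dvd 27"
        "h \<in> haupt_poly"
    for i r j l h
    using that(3,4)
  proof (rule numeral_dvd_sect_mult_haupt_poly[rotated])
    fix c
    have "sect 3 r (E 3 ^ j * E_inv 1 ^ l * of_int c)
        = E 1 ^ j * (of_int c * sect 3 r (E_inv 1 ^ l))"
      unfolding sect_of_int_mult [symmetric] sect_E_3_power_mult [OF that(1), symmetric]
      by (simp only: mult_ac)
    then show "numeral i dvd sect 3 r (E 3 ^ j * E_inv 1 ^ l * of_int c)"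
      using that(2) by simp
  qed
  have nine: "(9 :: int fps) dvd 27" by (rule dvdI[of _ _ 3]) simp
  have three: "(3 :: int fps) dvd 27" by (rule dvdI[of _ _ 9]) simp
  have 1: "3 ^ N dvd p3 C (K * n + (2 * K + C + 1) div 8)" for n
    unfolding odd by simp
  have 2: "3 ^ (N + 1) dvd p3 C (3 * K * n + (10 * K + C + 1) div 8)" for n
  proof -
    \<comment> \<open>The identity 10 K = 8 K + 2 K turns the offset into one further extraction at
      residue 1; the next two families likewise use 42 K = 24 K + 18 K and 66 K = 48 K + 18
      K.\<close>
    have i: "3 * K * n + (10 * K + C + 1) div 8 = K * (3 * n + 1) + (2 * K + C + 1) div 8"
      by (simp add: algebra_simps)
    have "3 dvd sect 3 1 (E 3 ^ 6 * E_inv 1 ^ 12 * f)"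
      by (intro const sect_1_E_inv_12 three f) simp
    then have "3 dvd fps_nth (E 3 ^ 6 * E_inv 1 ^ 12 * f) (3 * n + 1)"
      by (simp add: numeral_dvd_fps_iff)
    then show ?thesis unfolding i odd power_add by (intro mult_dvd_mono) simp_all
  qed
  have 3: "3 ^ (N + 2 + 2) dvd p3 C (9 * K * n + (14 * (3 * K) + C + 1) div 8)" for n
  proof -
    have i: "9 * K * n + (14 * (3 * K) + C + 1) div 8
        = 3 * K * (3 * n + 1) + (18 * K + C + 1) div 8"
      by (simp add: algebra_simps)
    have "9 dvd sect 3 1 (E 3 ^ 12 * E_inv 1 ^ 18 * g)"
      by (intro const sect_E_inv_18 nine g) simp
    then have "9 dvd fps_nth (E 3 ^ 12 * E_inv 1 ^ 18 * g) (3 * n + 1)"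
      by (simp add: numeral_dvd_fps_iff)
    then show ?thesis unfolding i even power_add[of _ "N + 2" 2] by (intro mult_dvd_mono) simp_all
  qed
  have 4: "3 ^ (N + 2 + 3) dvd p3 C (9 * K * n + (22 * (3 * K) + C + 1) div 8)" for n
  proof -
    have i: "9 * K * n + (22 * (3 * K) + C + 1) div 8
        = 3 * K * (3 * n + 2) + (18 * K + C + 1) div 8"
      by (simp add: algebra_simps)
    have "27 dvd sect 3 2 (E 3 ^ 12 * E_inv 1 ^ 18 * g)"
      by (intro const sect_E_inv_18 g) simp_all
    then have "27 dvd fps_nth (E 3 ^ 12 * E_inv 1 ^ 18 * g) (3 * n + 2)"
      by (simp add: numeral_dvd_fps_iff)
    then show ?thesis unfolding i even power_add[of _ "N + 2" 3] by (intro mult_dvd_mono) simp_all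
  qed
  have 5: "3 ^ (N + 2) dvd p3 C (K * p ^ (2 * k + 1) * n + (2 * p ^ (2 * k + 2) * K + C + 1) div 8)"
    if p: "prime p" "[p = 3] (mod 4)" "\<not> p dvd n" for p n
  proof -
    have p4: "p mod 4 = 3" using p(2) by (simp add: cong_def)
    then have "p ^ 2 mod 4 = 1" by (subst power_mod [symmetric]) simp
    then have "(p ^ 2) ^ (k + 1) mod 4 = 1" by (subst power_mod [symmetric]) simp
    moreover have "(p ^ 2) ^ (k + 1) = p ^ (2 * k + 2)"
      unfolding power_mult [symmetric] by simp
    ultimately have "p ^ (2 * k + 2) mod 4 = 1" by (simp only:)
    then obtain q where q: "p ^ (2 * k + 2) = 4 * q + 1" by (metis mult_div_mod_eq)
    \<comment> \<open>This index makes 4m + 1 = p^(2k+1) (4n + p), where p does not divide the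
      cofactor; hence p occurs to an odd power and 4m + 1 is not a sum of two squares.\<close>
    define m where "m = p ^ (2 * k + 1) * n + q"
    have "2 * p ^ (2 * k + 2) * K + C + 1 = 8 * (q * K) + (2 * K + C + 1)"
      unfolding q by (simp add: algebra_simps)
    then have i: "K * p ^ (2 * k + 1) * n + (2 * p ^ (2 * k + 2) * K + C + 1) div 8
        = K * m + (2 * K + C + 1) div 8"
      by (simp add: m_def algebra_simps)
    have "4 * m + 1 = p ^ (2 * k + 1) * (4 * n) + p ^ (2 * k + 2)"
      unfolding m_def q by (simp add: algebra_simps)
    also have "\<dots> = p ^ (2 * k + 1) * (4 * n + p)"
      by (simp add: algebra_simps)
    finally have eq: "4 * m + 1 = p ^ (2 * k + 1) * (4 * n + p)" .
    have "4 * int m + 1 = int (4 * m + 1)" by simp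
    also note eq
    finally have m: "4 * int m + 1 = int (p ^ (2 * k + 1) * (4 * n + p))" .
    have "\<not> p dvd 4"
    proof
      assume "p dvd 4"
      then have "p \<le> 4" by (intro dvd_imp_le) simp_all
      then have "p = 3" using p4 by presburger
      then show False using \<open>p dvd 4\<close> by simp
    qed
    then have "\<not> p dvd 4 * n + p"
      using p by (simp add: prime_dvd_mult_iff)
    then have "4 * int m + 1 \<noteq> x ^ 2 + y ^ 2" for x y
      using sum_squares_odd_prime_power[OF p(1) p4] unfolding m by blast
    then have E6: "fps_nth (E 1 ^ 6) m = 0" by (rule E_1_power_6_nth)
    obtain c where c: "27 dvd f - of_int c" using haupt_poly_const_mod_27[OF f(1)] .
    have "9 dvd E 3 ^ 6 * E_inv 1 ^ 12 * (f - of_int c)"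
      using c nine by (meson dvd_mult dvd_trans)
    moreover have "9 dvd (E 1 ^ 6 - E 3 ^ 6 * E_inv 1 ^ 12) * of_int c"
      using E_1_power_6_cong by simp
    ultimately have "9 dvd E 3 ^ 6 * E_inv 1 ^ 12 * (f - of_int c)
        - (E 1 ^ 6 - E 3 ^ 6 * E_inv 1 ^ 12) * of_int c"
      by (rule dvd_diff)
    also have "\<dots> = E 3 ^ 6 * E_inv 1 ^ 12 * f - of_int c * E 1 ^ 6"
      by (simp add: algebra_simps)
    finally have "9 dvd fps_nth (E 3 ^ 6 * E_inv 1 ^ 12 * f - of_int c * E 1 ^ 6) m"
      unfolding numeral_dvd_fps_iff by blast
    moreover have "fps_nth (of_int c * E 1 ^ 6) m = 0"
      using E6 by (simp flip: fps_of_int)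
    ultimately have "9 dvd fps_nth (E 3 ^ 6 * E_inv 1 ^ 12 * f) m"
      by (simp only: fps_sub_nth diff_0_right)
    then show ?thesis unfolding i odd power_add[of _ N 2] by (intro mult_dvd_mono) simp_all
  qed
  show ?thesis
    unfolding cong_0_iff N K N_def [symmetric] K_def [symmetric] C_def [symmetric]
    using 1 2 3 4 5 by blast
qed

end
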